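(* Let $\mathbf{Numb}/{\equiv_i}$ be the subclass of $\mathbf{PG}/{\equiv_i}$ consisting of those equivalence classes which are of the form $G/{\equiv_i}$ for some number $G$. Then $\mathbf{Numb}/{\equiv_i}$ is a SubRing of the Ring $\mathbf{PG}/{\equiv_i}$. The Class $\mathbf{C}$ of (the $\equiv_i$-classes of) Conway zero games in $\mathbf{Numb}/{\equiv_i}$ is an Ideal of $\mathbf{Numb}/{\equiv_i}$, and the Quotient of $\mathbf{Numb}/{\equiv_i}$ by this Ideal is isomorphic to the Class of surreal numbers.
   Context: Games: a combinatorial game $G$ is a (possibly infinite, possibly partizan) well-founded two-player game of perfect information under normal play, given by a set of Left options $G^L$ and a set of Right options $G^R$, which are themselves games; one writes $G=\{\,G^L\mid G^R\,\}$. $\mathbf{PG}$ is the (proper) class of all such games. Games are taken as forms, considered up to extensional equality. $0=\{\,\mid\,\}$, $1=\{\,0\mid\,\}$. Operations: $G+H$ has Left options $G^L+H$, $G+H^L$ and Right options $G^R+H$, $G+H^R$. $-G=\{\,-G^R\mid -G^L\,\}$, and $G-H=G+(-H)$. The Conway product $GH$ has Left options $G^LH+GH^L-G^LH^L$ and $G^RH+GH^R-G^RH^R$, and Right options $G^LH+GH^R-G^LH^R$ and $G^RH+GH^L-G^RH^L$, for arbitrary options of $G$ and $H$. Iteratively zero: recursively, $G$ is iteratively zero if for every Left option $G^L$ of $G$ there is a Right option $G^{LR}$ of $G^L$ which is iteratively zero, and for every Right option $G^R$ of $G$ there is a Left option $G^{RL}$ of $G^R$ which is iteratively zero. Define $G\equiv_i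 H$ if $G-H$ is iteratively zero. The relation $\equiv_i$ is an equivalence relation respecting $+$ and the Conway product, and $\mathbf{PG}/{\equiv_i}$ with the induced operations is a commutative Ring with unity. Conway zero and Conway equivalence: $G$ is Conway zero if the player moving second has a winning strategy on $G$; $G$ and $H$ are Conway equivalent, written $G=_c H$, if $G-H$ is Conway zero. The relation $\equiv_i$ is finer than $=_c$, so being Conway zero depends only on the $\equiv_i$-class. Numbers: $0<G$ means that Left has a winning strategy on $G$ whoever starts playing; $H<G$ means $0<G-H$. A number is a game $G$ such that $H^L<H^R$ for every (possibly improper) subposition $H$ of $G$ and all Left options $H^L$ and Right options $H^R$ of $H$. A surreal number is the $=_c$-class of some number; the Class of surreal numbers is a Field with the operations induced by $+$ and the Conway product. Capitalized words (Ring, SubRing, Ideal, Quotient, Field, Class) indicate that the underlying collection may be a proper class. *)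

theory Defs
  imports
    "HOL-Algebra.QuotRing"
    "HOL-Algebra.Subrings"
    "HOL-Library.Infinite_Typeclass"
begin

section \<open>Universes of games\<close>

text \<open>
  HOL has no proper classes. A type of class \<open>game_universe\<close> plays the role of the Class of all
  games, and \<open>small\<close> the role of ``is a set''. The axioms hold for the Class of all games:
  every game has a set of Left and a set of Right options, the option relation is well-founded,
  games are extensional, any two sets of games are the option sets of a game, and sets satisfy
  pairing, union, replacement and infinity. Powerset is not required, so that
  the games that hereditarily have at most \<open>\<kappa>\<close> options form a universe for each infinite
  cardinal \<open>\<kappa>\<close> (see the instance below).
\<close>

class game_universe =
  fixes lefts :: "'a \<Rightarrow> 'a set"
    and rights :: "'a \<Rightarrow> 'a set"
    and small :: "'a set \<Rightarrow> bool"
  assumes small_lefts: "small (lefts G)"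
    and small_rights: "small (rights G)"
    and wf_moves: "wf {(H, G). H \<in> lefts G \<union> rights G}"
    and game_ext: "lefts G = lefts H \<Longrightarrow> rights G = rights H \<Longrightarrow> G = H"
    and game_exists: "small A \<Longrightarrow> small B \<Longrightarrow> \<exists>G. lefts G = A \<and> rights G = B"
    and small_empty: "small {}"
    and small_insert: "small A \<Longrightarrow> small (insert G A)"
    and small_UN: "small A \<Longrightarrow> (\<And>G. G \<in> A \<Longrightarrow> small (F G)) \<Longrightarrow> small (\<Union>G\<in>A. F G)"
    and small_infinite: "\<exists>A. small A \<and> infinite A"

subsection \<open>The games with hereditarily at most as many options as a given infinite type\<close>

datatype 'i pregame = Pregame (pre_lefts: "'i \<rightharpoonup> 'i pregame") (pre_rights: "'i \<rightharpoonup> 'i pregame")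

coinductive ext_eq :: "'i pregame \<Rightarrow> 'i pregame \<Rightarrow> bool" where
  "\<lbrakk>\<forall>a\<in>ran (pre_lefts P). \<exists>b\<in>ran (pre_lefts Q). ext_eq a b;
    \<forall>b\<in>ran (pre_lefts Q). \<exists>a\<in>ran (pre_lefts P). ext_eq a b;
    \<forall>a\<in>ran (pre_rights P). \<exists>b\<in>ran (pre_rights Q). ext_eq a b;
    \<forall>b\<in>ran (pre_rights Q). \<exists>a\<in>ran (pre_rights P). ext_eq a b\<rbrakk> \<Longrightarrow> ext_eq P Q"

lemma ext_eq_bisim:
  assumes "R P Q"
    and "\<And>P Q a. R P Q \<Longrightarrow> a \<in> ran (pre_lefts P) \<Longrightarrow> \<exists>b\<in>ran (pre_lefts Q). R a b"
    and "\<And>P Q b. R P Q \<Longrightarrow> b \<in> ran (pre_lefts Q) \<Longrightarrow> \<exists>a\<in>ran (pre_lefts P). R a b"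
    and "\<And>P Q a. R P Q \<Longrightarrow> a \<in> ran (pre_rights P) \<Longrightarrow> \<exists>b\<in>ran (pre_rights Q). R a b"
    and "\<And>P Q b. R P Q \<Longrightarrow> b \<in> ran (pre_rights Q) \<Longrightarrow> \<exists>a\<in>ran (pre_rights P). R a b"
  shows "ext_eq P Q"
proof (rule ext_eq.coinduct[of R], rule assms(1), intro exI conjI refl ballI)
  fix P Q assume R: "R P Q"
  note * = assms(2-5)[OF R]
  show "\<exists>b\<in>ran (pre_lefts Q). R a b \<or> ext_eq a b" if "a \<in> ran (pre_lefts P)" for a
    using *(1)[OF that] by blast
  show "\<exists>a\<in>ran (pre_lefts P). R a b \<or> ext_eq a b" if "b \<in> ran (pre_lefts Q)" for b
    using *(2)[OF that] by blast
  show "\<exists>b\<in>ran (pre_rights Q). R a b \<or> ext_eq a b" if "a \<in> ran (pre_rights P)" for a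
    using *(3)[OF that] by blast
  show "\<exists>a\<in>ran (pre_rights P). R a b \<or> ext_eq a b" if "b \<in> ran (pre_rights Q)" for b
    using *(4)[OF that] by blast
qed simp_all

lemma ext_eq_refl: "ext_eq P P"
  by (rule ext_eq_bisim[of "(=)"]) simp_all

lemma ext_eqD:
  assumes "ext_eq P Q"
  shows "a \<in> ran (pre_lefts P) \<Longrightarrow> \<exists>b\<in>ran (pre_lefts Q). ext_eq a b"
    and "b \<in> ran (pre_lefts Q) \<Longrightarrow> \<exists>a\<in>ran (pre_lefts P). ext_eq a b"
    and "c \<in> ran (pre_rights P) \<Longrightarrow> \<exists>d\<in>ran (pre_rights Q). ext_eq c d"
    and "d \<in> ran (pre_rights Q) \<Longrightarrow> \<exists>c\<in>ran (pre_rights P). ext_eq c d"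
  using assms by (blast elim: ext_eq.cases)+

lemma ext_eq_sym: "ext_eq P Q \<Longrightarrow> ext_eq Q P"
  by (rule ext_eq_bisim[of "\<lambda>P Q. ext_eq Q P"]) (simp_all add: ext_eqD)

lemma ext_eq_trans:
  assumes "ext_eq P Q" "ext_eq Q R"
  shows "ext_eq P R"
proof (rule ext_eq_bisim[of "ext_eq OO ext_eq"])
  show "(ext_eq OO ext_eq) P R" using assms by blast
qed (elim relcomppE, meson ext_eqD relcomppI)+

quotient_type 'i game = "'i pregame" / ext_eq
  by (rule equivpI) (auto intro!: reflpI sympI transpI intro: ext_eq_refl ext_eq_sym ext_eq_trans)

lemma abs_game_eq_iff: "abs_game P = abs_game Q \<longleftrightarrow> ext_eq P Q"
  using game.abs_eq_iff by blast

lemma ext_eq_rep_abs: "ext_eq (rep_game (abs_game P)) P"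
  using Quotient_rep_abs[OF Quotient_game ext_eq_refl] .

lemma abs_rep_game: "abs_game (rep_game G) = G"
  using Quotient_abs_rep[OF Quotient_game] .

instantiation game :: (infinite) game_universe
begin

definition lefts_game :: "'a game \<Rightarrow> 'a game set" where
  "lefts_game G = abs_game ` ran (pre_lefts (rep_game G))"

definition rights_game :: "'a game \<Rightarrow> 'a game set" where
  "rights_game G = abs_game ` ran (pre_rights (rep_game G))"

definition small_game :: "'a game set \<Rightarrow> bool" where
  "small_game A \<longleftrightarrow> (\<exists>f :: 'a \<Rightarrow> 'a game. A \<subseteq> range f)"

lemma lefts_abs_game: "lefts (abs_game P) = abs_game ` ran (pre_lefts P)"
proof
  note D = ext_eqD[OF ext_eq_rep_abs[of P]]
  show "lefts (abs_game P) \<subseteq> abs_game ` ran (pre_lefts P)"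
    unfolding lefts_game_def by (rule image_subsetI) (metis D(1) abs_game_eq_iff image_eqI)
  show "abs_game ` ran (pre_lefts P) \<subseteq> lefts (abs_game P)"
    unfolding lefts_game_def by (rule image_subsetI) (metis D(2) abs_game_eq_iff image_eqI)
qed

lemma rights_abs_game: "rights (abs_game P) = abs_game ` ran (pre_rights P)"
proof
  note D = ext_eqD[OF ext_eq_rep_abs[of P]]
  show "rights (abs_game P) \<subseteq> abs_game ` ran (pre_rights P)"
    unfolding rights_game_def by (rule image_subsetI) (metis D(3) abs_game_eq_iff image_eqI)
  show "abs_game ` ran (pre_rights P) \<subseteq> rights (abs_game P)"
    unfolding rights_game_def by (rule image_subsetI) (metis D(4) abs_game_eq_iff image_eqI)
qed

lemma small_abs_ran: "small (abs_game ` ran (m :: 'a \<rightharpoonup> 'a pregame))"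
proof -
  have "abs_game ` ran m \<subseteq> range (\<lambda>i. abs_game (the (m i)))"
  proof (rule image_subsetI)
    fix p assume "p \<in> ran m"
    then obtain i where "m i = Some p" by (auto simp: ran_def)
    then show "abs_game p \<in> range (\<lambda>i. abs_game (the (m i)))"
      by (intro image_eqI[of _ _ i]) simp_all
  qed
  then show ?thesis unfolding small_game_def by blast
qed

lemma small_eq_abs_ran:
  assumes "small (A :: 'a game set)"
  shows "\<exists>m :: 'a \<rightharpoonup> 'a pregame. A = abs_game ` ran m"
proof -
  obtain f :: "'a \<Rightarrow> 'a game" where f: "A \<subseteq> range f"
    using assms unfolding small_game_def by blast
  have "A = abs_game ` ran (\<lambda>i. if f i \<in> A then Some (rep_game (f i)) else None)"
  proof
    show "A \<subseteq> abs_game ` ran (\<lambda>i. if f i \<in> A then Some (rep_game (f i)) else None)"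
    proof
      fix G assume "G \<in> A"
      with f obtain i where "G = f i" by blast
      with \<open>G \<in> A\<close>
      have "rep_game G \<in> ran (\<lambda>i. if f i \<in> A then Some (rep_game (f i)) else None)"
        by (intro ranI[of _ i]) simp
      then show "G \<in> abs_game ` ran (\<lambda>i. if f i \<in> A then Some (rep_game (f i)) else None)"
        by (intro image_eqI[of _ _ "rep_game G"]) (simp_all only: abs_rep_game)
    qed
  qed (auto simp: ran_def abs_rep_game split: if_splits)
  then show ?thesis by blast
qed

lemma ex_surj_pair: "\<exists>h :: 'a \<Rightarrow> 'a \<times> 'a. surj h"
proof -
  obtain g :: "'a \<times> 'a \<Rightarrow> 'a" where "bij_betw g (UNIV \<times> UNIV) UNIV"
    using card_of_Times_same_infinite[OF infinite_UNIV] card_of_ordIso by blast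
  then have "surj (inv_into UNIV g)" by (simp add: bij_imp_bij_inv bij_is_surj)
  then show ?thesis by blast
qed

lemma game_induct_abs:
  assumes "\<And>G. (\<And>H. H \<in> lefts G \<union> rights G \<Longrightarrow> Q H) \<Longrightarrow> Q G"
  shows "Q (abs_game (P :: 'a pregame))"
proof (induction P)
  case (Pregame l r)
  have l: "Q (abs_game p)" if "p \<in> ran l" for p
  proof -
    from that obtain i where "l i = Some p" by (auto simp: ran_def)
    then show ?thesis using Pregame(1)[OF rangeI[of l i], of p] by simp
  qed
  have r: "Q (abs_game p)" if "p \<in> ran r" for p
  proof -
    from that obtain i where "r i = Some p" by (auto simp: ran_def)
    then show ?thesis using Pregame(2)[OF rangeI[of r i], of p] by simp
  qed
  show ?case
  proof (rule assms)
    fix H assume "H \<in> lefts (abs_game (Pregame l r)) \<union> rights (abs_game (Pregame l r))"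
    then have "H \<in> abs_game ` ran l \<union> abs_game ` ran r"
      by (simp add: lefts_abs_game rights_abs_game)
    then show "Q H" using l r by blast
  qed
qed

instance
proof
  fix G H :: "'a game" and A B :: "'a game set" and F :: "'a game \<Rightarrow> 'a game set"
  show "small (lefts G)" "small (rights G)"
    unfolding lefts_game_def rights_game_def by (rule small_abs_ran)+
  show wf: "wf {(H, G :: 'a game). H \<in> lefts G \<union> rights G}"
  proof (rule wfUNIVI)
    fix Q :: "'a game \<Rightarrow> bool" and G :: "'a game"
    assume "\<forall>G. (\<forall>H. (H, G) \<in> {(H, G). H \<in> lefts G \<union> rights G} \<longrightarrow> Q H) \<longrightarrow> Q G"
    then have "Q (abs_game (rep_game G))"
      by (intro game_induct_abs[of Q "rep_game G"]) blast
    then show "Q G" by (simp add: abs_rep_game)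
  qed
  show "G = H" if "lefts G = lefts H" "rights G = rights H"
  proof -
    have transfer: "\<exists>b\<in>B. ext_eq a b" "\<exists>b\<in>B. ext_eq b a"
      if "abs_game ` A = abs_game ` B" "a \<in> A" for a :: "'a pregame" and A B
    proof -
      from that have "abs_game a \<in> abs_game ` B" by blast
      then obtain b where b: "b \<in> B" "abs_game a = abs_game b" by blast
      then have "ext_eq a b" "ext_eq b a" by (simp_all flip: abs_game_eq_iff)
      with b show "\<exists>b\<in>B. ext_eq a b" "\<exists>b\<in>B. ext_eq b a" by blast+
    qed
    have "ext_eq (rep_game G) (rep_game H)"
      using that unfolding lefts_game_def rights_game_def
      by (intro ext_eq.intros ballI)
        (erule (1) transfer(1), erule (1) transfer(2)[OF sym], erule (1) transfer(1),
          erule (1) transfer(2)[OF sym])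
    then have "abs_game (rep_game G) = abs_game (rep_game H)" by (simp only: abs_game_eq_iff)
    then show ?thesis by (simp only: abs_rep_game)
  qed
  show "\<exists>G. lefts G = A \<and> rights G = B" if "small A" "small B"
  proof -
    obtain l :: "'a \<rightharpoonup> 'a pregame" where "A = abs_game ` ran l"
      using small_eq_abs_ran[OF \<open>small A\<close>] by blast
    moreover obtain r :: "'a \<rightharpoonup> 'a pregame" where "B = abs_game ` ran r"
      using small_eq_abs_ran[OF \<open>small B\<close>] by blast
    ultimately show ?thesis
      by (intro exI[of _ "abs_game (Pregame l r)"]) (simp add: lefts_abs_game rights_abs_game)
  qed
  show empty: "small ({} :: 'a game set)" unfolding small_game_def by simp
  obtain h :: "'a \<Rightarrow> 'a \<times> 'a" where h: "surj h" using ex_surj_pair by blast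
  show "small (\<Union>G\<in>A. F G)" if "small A" "\<And>G. G \<in> A \<Longrightarrow> small (F G)"
    for A :: "'a game set" and F :: "'a game \<Rightarrow> 'a game set"
  proof -
    obtain f :: "'a \<Rightarrow> 'a game" where f: "A \<subseteq> range f"
      using \<open>small A\<close> unfolding small_game_def by blast
    have "\<forall>G\<in>A. \<exists>g :: 'a \<Rightarrow> 'a game. F G \<subseteq> range g"
      using that(2) unfolding small_game_def by blast
    then obtain g where g: "\<And>G. G \<in> A \<Longrightarrow> F G \<subseteq> range (g G :: 'a \<Rightarrow> 'a game)"
      using bchoice[of A "\<lambda>G g. F G \<subseteq> range (g :: 'a \<Rightarrow> 'a game)"] by blast
    have "(\<Union>G\<in>A. F G) \<subseteq> range ((\<lambda>(i, j). g (f i) j) \<circ> h)"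
    proof
      fix K assume "K \<in> (\<Union>G\<in>A. F G)"
      then obtain G where "G \<in> A" "K \<in> F G" by blast
      then obtain i j where "G = f i" "K = g G j" using f g by blast
      moreover obtain k where "h k = (i, j)" using h by (metis surjD)
      ultimately show "K \<in> range ((\<lambda>(i, j). g (f i) j) \<circ> h)"
        by (intro image_eqI[of _ _ k]) auto
    qed
    then show ?thesis unfolding small_game_def by blast
  qed
  show ins: "small (insert G A)" if A: "small A" for G :: "'a game" and A
  proof -
    obtain f :: "'a \<Rightarrow> 'a game" where f: "A \<subseteq> range f"
      using A unfolding small_game_def by blast
    let ?a = "undefined :: 'a"
    obtain b :: 'a where "b \<notin> {?a}" using arb_element[of "{?a}"] by blast
    have "insert G A \<subseteq> range ((\<lambda>(i, j). if i = ?a then G else f j) \<circ> h)"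
    proof
      fix K assume K: "K \<in> insert G A"
      show "K \<in> range ((\<lambda>(i, j). if i = ?a then G else f j) \<circ> h)"
      proof (cases "K = G")
        case True
        obtain k where "h k = (?a, ?a)" using h by (metis surjD)
        with True show ?thesis by (intro image_eqI[of _ _ k]) auto
      next
        case False
        with K f obtain j where "K = f j" by blast
        moreover obtain k where "h k = (b, j)" using h by (metis surjD)
        ultimately show ?thesis using \<open>b \<notin> {?a}\<close> by (intro image_eqI[of _ _ k]) auto
      qed
    qed
    then show ?thesis unfolding small_game_def by blast
  qed
  show "\<exists>A :: 'a game set. small A \<and> infinite A"
  proof -
    have univ_not_small: "\<not> small (UNIV :: 'a game set)"
    proof
      assume "small (UNIV :: 'a game set)"
      then obtain l :: "'a \<rightharpoonup> 'a pregame" where "UNIV = abs_game ` ran l"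
        using small_eq_abs_ran by blast
      then have "abs_game (Pregame l l) \<in> lefts (abs_game (Pregame l l))"
        by (simp add: lefts_abs_game)
      with wf show False by (blast dest: wf_not_refl)
    qed
    have "small B" if "finite B" for B :: "'a game set"
      using that by (induction B) (auto intro: empty ins)
    with univ_not_small have "infinite (UNIV :: 'a game set)" by blast
    then obtain f :: "nat \<Rightarrow> 'a game" where f: "inj f"
      using infinite_countable_subset by blast
    obtain e :: "nat \<Rightarrow> 'a" where e: "inj e"
      using infinite_countable_subset[OF infinite_UNIV] by blast
    have "range f \<subseteq> range (f \<circ> inv_into UNIV e)"
    proof
      fix K assume "K \<in> range f"
      then obtain n where "K = f n" by blast
      then show "K \<in> range (f \<circ> inv_into UNIV e)"
        using e by (intro image_eqI[of _ _ "e n"]) simp_all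
    qed
    then have "small (range f)" unfolding small_game_def by blast
    moreover have "infinite (range f)" using f by (simp add: range_inj_infinite)
    ultimately show ?thesis by blast
  qed
qed

end

section \<open>Operations\<close>

definition game_of :: "'g::game_universe set \<Rightarrow> 'g set \<Rightarrow> 'g" where
  "game_of A B = (THE G. lefts G = A \<and> rights G = B)"

definition option_rel :: "('g::game_universe \<times> 'g) set" where
  "option_rel = {(H, G). H \<in> lefts G \<union> rights G}"

lemma wf_option_rel: "wf option_rel"
  unfolding option_rel_def by (rule wf_moves)

definition gzero :: "'g::game_universe" where
  "gzero = game_of {} {}"

definition gone :: "'g::game_universe" where
  "gone = game_of {gzero} {}"

function gneg :: "'g::game_universe \<Rightarrow> 'g" where
  "gneg G = game_of (gneg ` rights G) (gneg ` lefts G)"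
  by pat_completeness auto
termination
  by (relation option_rel) (auto simp: wf_option_rel, auto simp: option_rel_def)

declare gneg.simps [simp del]

function gplus :: "'g::game_universe \<Rightarrow> 'g \<Rightarrow> 'g" where
  "gplus G H = game_of
     ((\<lambda>GL. gplus GL H) ` lefts G \<union> (\<lambda>HL. gplus G HL) ` lefts H)
     ((\<lambda>GR. gplus GR H) ` rights G \<union> (\<lambda>HR. gplus G HR) ` rights H)"
  by pat_completeness auto
termination
  by (relation "option_rel <*lex*> option_rel")
    (auto simp: wf_option_rel, auto simp: option_rel_def)

declare gplus.simps [simp del]

definition gminus :: "'g::game_universe \<Rightarrow> 'g \<Rightarrow> 'g" where
  "gminus G H = gplus G (gneg H)"

function gtimes :: "'g::game_universe \<Rightarrow> 'g \<Rightarrow> 'g" where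
  "gtimes G H = game_of
     ((\<Union>GL\<in>lefts G. \<Union>HL\<in>lefts H.
         {gminus (gplus (gtimes GL H) (gtimes G HL)) (gtimes GL HL)}) \<union>
      (\<Union>GR\<in>rights G. \<Union>HR\<in>rights H.
         {gminus (gplus (gtimes GR H) (gtimes G HR)) (gtimes GR HR)}))
     ((\<Union>GL\<in>lefts G. \<Union>HR\<in>rights H.
         {gminus (gplus (gtimes GL H) (gtimes G HR)) (gtimes GL HR)}) \<union>
      (\<Union>GR\<in>rights G. \<Union>HL\<in>lefts H.
         {gminus (gplus (gtimes GR H) (gtimes G HL)) (gtimes GR HL)}))"
  by pat_completeness auto
termination
  by (relation "option_rel <*lex*> option_rel")
    (auto simp: wf_option_rel, auto simp: option_rel_def)

declare gtimes.simps [simp del]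


section \<open>Strategies and Conway equivalence\<close>

datatype player = Left | Right

fun opponent :: "player \<Rightarrow> player" where
  "opponent Left = Right"
| "opponent Right = Left"

fun moves :: "player \<Rightarrow> 'g::game_universe \<Rightarrow> 'g set" where
  "moves Left G = lefts G"
| "moves Right G = rights G"

text \<open>
  A strategy of player \<open>p\<close> is a map \<open>\<sigma>\<close> from histories (non-empty lists of positions, the current
  position first) to positions. \<open>reachable p \<sigma> q G hs r\<close> says that, if \<open>q\<close> starts on \<open>G\<close> and \<open>p\<close>
  follows \<open>\<sigma>\<close>, then the history \<open>hs\<close> can arise with \<open>r\<close> to move.
\<close>

inductive reachable ::
  "player \<Rightarrow> ('g::game_universe list \<Rightarrow> 'g) \<Rightarrow> player \<Rightarrow> 'g \<Rightarrow> 'g list \<Rightarrow> player \<Rightarrow> bool"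
  for p \<sigma> q G where
  start: "reachable p \<sigma> q G [G] q"
| own_move: "reachable p \<sigma> q G (H # hs) p \<Longrightarrow> \<sigma> (H # hs) \<in> moves p H \<Longrightarrow>
    reachable p \<sigma> q G (\<sigma> (H # hs) # H # hs) (opponent p)"
| opponent_move: "reachable p \<sigma> q G (H # hs) (opponent p) \<Longrightarrow> K \<in> moves (opponent p) H \<Longrightarrow>
    reachable p \<sigma> q G (K # H # hs) p"

text \<open>
  Every play is finite and is lost by the player who cannot move, so \<open>\<sigma>\<close> wins for \<open>p\<close> exactly if it
  provides a legal move whenever \<open>p\<close> has to move.
\<close>

definition winning_strategy ::
  "player \<Rightarrow> ('g::game_universe list \<Rightarrow> 'g) \<Rightarrow> player \<Rightarrow> 'g \<Rightarrow> bool" where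
  "winning_strategy p \<sigma> q G \<longleftrightarrow>
     (\<forall>H hs. reachable p \<sigma> q G (H # hs) p \<longrightarrow> \<sigma> (H # hs) \<in> moves p H)"

text \<open>Player \<open>p\<close> has a winning strategy on \<open>G\<close> when \<open>q\<close> starts.\<close>

definition wins :: "player \<Rightarrow> player \<Rightarrow> 'g::game_universe \<Rightarrow> bool" where
  "wins p q G \<longleftrightarrow> (\<exists>\<sigma>. winning_strategy p \<sigma> q G)"

definition conway_zero :: "'g::game_universe \<Rightarrow> bool" where
  "conway_zero G \<longleftrightarrow> (\<forall>q. wins (opponent q) q G)"

definition conway_eq :: "('g::game_universe \<times> 'g) set" where
  "conway_eq = {(G, H). conway_zero (gminus G H)}"

definition gless :: "'g::game_universe \<Rightarrow> 'g \<Rightarrow> bool" where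
  "gless H G \<longleftrightarrow> (\<forall>q. wins Left q (gminus G H))"

definition number :: "'g::game_universe \<Rightarrow> bool" where
  "number G \<longleftrightarrow> (\<forall>H. (H, G) \<in> option_rel\<^sup>* \<longrightarrow> (\<forall>HL\<in>lefts H. \<forall>HR\<in>rights H. gless HL HR))"


section \<open>Iterative equivalence and the rings\<close>

inductive iter_zero :: "'g::game_universe \<Rightarrow> bool" where
  "(\<forall>GL\<in>lefts G. \<exists>GLR\<in>rights GL. iter_zero GLR) \<Longrightarrow>
   (\<forall>GR\<in>rights G. \<exists>GRL\<in>lefts GR. iter_zero GRL) \<Longrightarrow> iter_zero G"

definition iter_eq :: "('g::game_universe \<times> 'g) set" where
  "iter_eq = {(G, H). iter_zero (gminus G H)}"

text \<open>
  As for \<^const>\<open>FactRing\<close>, sum and product of two classes are the unions of the classes of all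
  sums and products of representatives; these unions are single classes because the operations
  respect the equivalence.
\<close>

definition PG_ring :: "'g::game_universe set ring" where
  "PG_ring =
    \<lparr>carrier = UNIV // iter_eq,
     mult = (\<lambda>X Y. \<Union>G\<in>X. \<Union>H\<in>Y. iter_eq `` {gtimes G H}),
     one = iter_eq `` {gone},
     zero = iter_eq `` {gzero},
     add = (\<lambda>X Y. \<Union>G\<in>X. \<Union>H\<in>Y. iter_eq `` {gplus G H})\<rparr>"

definition Numb_classes :: "'g::game_universe set set" where
  "Numb_classes = {iter_eq `` {G} | G. number G}"

definition Numb_ring :: "'g::game_universe set ring" where
  "Numb_ring = PG_ring\<lparr>carrier := Numb_classes\<rparr>"

definition Conway_zero_classes :: "'g::game_universe set set" where
  "Conway_zero_classes = Numb_classes \<inter> {iter_eq `` {G} | G. conway_zero G}"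

text \<open>
  A surreal number is a Conway class in the Class of all games, so it also contains games that are
  not numbers. The Conway product respects Conway equivalence only between numbers, so the
  operations are induced from the representatives that are numbers.
\<close>

definition surreal_ring :: "'g::game_universe set ring" where
  "surreal_ring =
    \<lparr>carrier = {conway_eq `` {G} | G. number G},
     mult = (\<lambda>X Y. \<Union>G\<in>Collect number \<inter> X. \<Union>H\<in>Collect number \<inter> Y. conway_eq `` {gtimes G H}),
     one = conway_eq `` {gone},
     zero = conway_eq `` {gzero},
     add = (\<lambda>X Y. \<Union>G\<in>Collect number \<inter> X. \<Union>H\<in>Collect number \<inter> Y. conway_eq `` {gplus G H})\<rparr>"

end

theory Submission
  imports Defs "HOL-Library.Multiset"
begin

text \<open>
  Games modulo \<open>\<equiv>\<^sub>i\<close> form a type \<open>igame\<close>. Its additive group laws come from identities of forms;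
  distributivity and associativity follow by comparing options, because modulo \<open>\<equiv>\<^sub>i\<close> an option of
  a product has the form \<open>GH - (G - G')(H - H')\<close>. Nonnegativity is invariant under \<open>\<equiv>\<^sub>i\<close>, and a
  game is Conway zero if and only if it and its negative are nonnegative. Numbers are closed under
  the product, and a product of numbers is Conway zero if one factor is, by Conway's simultaneous
  induction, run here over multisets of two or three numbers. Hence the Conway zero classes are the
  kernel of the surjective homomorphism that sends \<open>G/\<equiv>\<^sub>i\<close> to \<open>G/=\<^sub>c\<close>.
\<close>

section \<open>Options and iteratively zero games\<close>

text \<open>Distributivity fails for forms: the option (G' + H)K + (G + H)K' - (G' + H)K' contains
  HK' - HK', which is iteratively zero but in general not the form 0. The relation
  \<open>\<equiv>\<^sub>i\<close> is coarse enough to discard such differences and fine enough to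
  respect the product on all games, whereas Conway equivalence respects it only between numbers. So
  ring identities are settled for all games at the level of \<open>igame\<close>, and the order is
  then a predicate on that commutative ring, where comparing two options of a product means
  splitting a difference into products of differences. An option of GH belongs to Left exactly if
  both moves it is built from are made by the same player. This is a sign rule, and writing
  inequalities with signs lets one argument serve both players. The obstacle for numbers is
  circularity: the sign of (G - G')(H - H') would follow from GH being a number, but proving that GH
  is a number already requires comparing its options. Hence a separate monotonicity statement about
  two numbers and a factor is carried along.\<close>

lemma game_induct [case_names options]:
  assumes "\<And>G. (\<And>p G'. G' \<in> moves p G \<Longrightarrow> P G') \<Longrightarrow> P G"
  shows "P (G :: 'g::game_universe)"
proof (induction G rule: wf_induct_rule[OF wf_option_rel])
  case (1 G)
  show ?case
  proof (rule assms)
    show "P G'" if "G' \<in> moves p G" for p G'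
      using that by (intro 1) (cases p; simp add: option_rel_def)
  qed
qed

lemma game_induct2 [case_names options]:
  assumes "\<And>G H. (\<And>p G' H'. G' \<in> moves p G \<Longrightarrow> P G' H') \<Longrightarrow>
    (\<And>p H'. H' \<in> moves p H \<Longrightarrow> P G H') \<Longrightarrow> P G H"
  shows "P (G :: 'g::game_universe) (H :: 'h::game_universe)"
proof (induction G arbitrary: H rule: game_induct)
  case (options G)
  note outer = this
  show ?case
    by (induction H rule: game_induct) (use assms outer in blast)
qed

lemma game_induct3 [case_names options]:
  assumes "\<And>G H K. (\<And>p G' H' K'. G' \<in> moves p G \<Longrightarrow> P G' H' K') \<Longrightarrow>
    (\<And>p H' K'. H' \<in> moves p H \<Longrightarrow> P G H' K') \<Longrightarrow>
    (\<And>p K'. K' \<in> moves p K \<Longrightarrow> P G H K') \<Longrightarrow> P G H K"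
  shows "P (G :: 'g::game_universe) (H :: 'h::game_universe) (K :: 'k::game_universe)"
proof (induction G arbitrary: H K rule: game_induct)
  case (options G H K)
  note outer = this
  show ?case
  proof (induction H arbitrary: K rule: game_induct)
    case (options H K)
    note inner = this
    show ?case
      by (induction K rule: game_induct) (use assms outer inner in blast)
  qed
qed

text \<open>\<open>iter_zero\<close> recurses to positions two moves ahead, so inductions on it
  descend by a move and a reply. Carrying the claim for all options along reduces this to ordinary
  induction.\<close>

lemma game_induct_twostep [case_names options]:
  assumes "\<And>G. (\<And>p q G' G''. G' \<in> moves p G \<Longrightarrow> G'' \<in> moves q G' \<Longrightarrow> P G'') \<Longrightarrow> P G"
  shows "P (G :: 'g::game_universe)"
proof -
  have "P G \<and> (\<forall>p. \<forall>G'\<in>moves p G. P G')"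
    by (induction G rule: game_induct) (metis assms)
  then show ?thesis ..
qed

lemma opponent_opponent [simp]: "opponent (opponent p) = p"
  by (cases p) simp_all

lemma opponent_neq [simp]: "opponent p \<noteq> p" "p \<noteq> opponent p"
  by (cases p; simp)+

lemma all_player: "(\<forall>p. P p) \<longleftrightarrow> P Left \<and> P Right"
  by (auto intro: player.induct[of P])

lemma ex_player: "(\<exists>p. P p) \<longleftrightarrow> P Left \<or> P Right"
  using all_player[of "\<lambda>p. \<not> P p"] by blast

section \<open>Options of the basic constructions\<close>

lemma game_eqI: "(\<And>p. moves p G = moves p H) \<Longrightarrow> G = H"
  using game_ext[of G H] by (metis moves.simps)

lemma moves_game_of:
  assumes "small A" "small B"
  shows "moves p (game_of A B) = (if p = Left then A else B)"
proof -
  obtain G where G: "lefts G = A \<and> rights G = B"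
    using game_exists[OF assms] by blast
  have "lefts (game_of A B) = A \<and> rights (game_of A B) = B"
    unfolding game_of_def by (rule theI[of _ G]) (use G game_ext in auto)
  then show ?thesis by (cases p) simp_all
qed

lemma small_image:
  fixes f :: "'g::game_universe \<Rightarrow> 'g"
  assumes "small A"
  shows "small (f ` A)"
proof -
  have "small (\<Union>G\<in>A. {f G})"
    by (intro small_UN small_insert small_empty assms)
  then show ?thesis by (simp add: UNION_singleton_eq_range)
qed

lemma moves_gzero [simp]: "moves p gzero = {}"
  by (simp add: gzero_def moves_game_of small_empty)

lemma moves_gone: "moves p gone = (if p = Left then {gzero} else {})"
  by (simp add: gone_def moves_game_of small_empty small_insert)

lemma gzero_neq_gone: "gzero \<noteq> gone"
proof
  assume "gzero = (gone :: 'a)"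
  then have "moves Left gzero = moves Left (gone :: 'a)" by simp
  then show False by (simp add: moves_gone)
qed

text \<open>The union axiom speaks of families indexed by a small set of games. Two distinct games,
  \<open>gzero\<close> and \<open>gone\<close>, serve as indices for the two sets.\<close>

lemma small_Un:
  assumes "small A" "small B"
  shows "small (A \<union> B :: 'g::game_universe set)"
proof -
  have "small (\<Union>G\<in>{gzero, gone :: 'g}. if G = gzero then A else B)"
    by (rule small_UN) (auto intro: small_insert small_empty assms)
  then show ?thesis using gzero_neq_gone[where 'a = 'g] by (simp add: Un_commute)
qed

lemmas small_intros =
  small_Un small_UN small_image small_lefts small_rights small_insert small_empty

lemma moves_gneg: "moves p (gneg G) = gneg ` moves (opponent p) G"
  by (subst gneg.simps, subst moves_game_of, (intro small_intros)+, cases p) simp_all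

lemma moves_gplus:
  "moves p (gplus G H) = (\<lambda>G'. gplus G' H) ` moves p G \<union> (\<lambda>H'. gplus G H') ` moves p H"
  by (subst gplus.simps, subst moves_game_of, (intro small_intros)+, cases p) simp_all

text \<open>Naming the players \<open>a\<close> and \<open>b\<close> of the two moves merges the
  four families of options. Their owner is given by parity, which is what makes commutativity,
  associativity and the signs below uniform.\<close>

lemma moves_gtimes:
  "K \<in> moves p (gtimes G H) \<longleftrightarrow> (\<exists>a b. \<exists>G'\<in>moves a G. \<exists>H'\<in>moves b H.
     (p = Left \<longleftrightarrow> a = b) \<and> K = gminus (gplus (gtimes G' H) (gtimes G H')) (gtimes G' H'))"
  by (subst gtimes.simps, subst moves_game_of, (intro small_intros)+, cases p)
    (simp_all add: ex_player)

section \<open>Sum and negation as identities of forms\<close>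

lemma gplus_commute: "gplus G H = gplus H G"
proof (induction G H rule: game_induct2)
  case (options G H)
  show ?case
  proof (rule game_eqI)
    fix p
    have "(\<lambda>G'. gplus G' H) ` moves p G = (\<lambda>G'. gplus H G') ` moves p G"
      by (intro image_cong refl options)
    moreover have "(\<lambda>H'. gplus G H') ` moves p H = (\<lambda>H'. gplus H' G) ` moves p H"
      by (intro image_cong refl options)
    ultimately show "moves p (gplus G H) = moves p (gplus H G)"
      unfolding moves_gplus by blast
  qed
qed

lemma gplus_assoc: "gplus (gplus G H) K = gplus G (gplus H K)"
proof (induction G H K rule: game_induct3)
  case (options G H K)
  show ?case
    by (rule game_eqI) (simp add: moves_gplus options image_Un image_image Un_assoc cong: image_cong)
qed

lemma gplus_gzero [simp]: "gplus G gzero = G"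
proof (induction G rule: game_induct)
  case (options G)
  then show ?case by (intro game_eqI) (simp add: moves_gplus cong: image_cong)
qed

lemma gneg_gneg [simp]: "gneg (gneg G) = G"
proof (induction G rule: game_induct)
  case (options G)
  then show ?case by (intro game_eqI) (simp add: moves_gneg image_image cong: image_cong)
qed

lemma gneg_gplus: "gneg (gplus G H) = gplus (gneg G) (gneg H)"
proof (induction G H rule: game_induct2)
  case (options G H)
  show ?case
    by (rule game_eqI) (simp add: moves_gplus moves_gneg options image_Un image_image cong: image_cong)
qed

lemma gneg_gzero [simp]: "gneg gzero = gzero"
  by (rule game_eqI) (simp add: moves_gneg)

section \<open>Iteratively zero games and sums\<close>

lemma iter_zero_iff:
  "iter_zero G \<longleftrightarrow> (\<forall>p. \<forall>G'\<in>moves p G. \<exists>G''\<in>moves (opponent p) G'. iter_zero G'')"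
  by (subst iter_zero.simps) (simp add: all_player)

lemma iter_zeroD: "iter_zero G \<Longrightarrow> G' \<in> moves p G \<Longrightarrow> \<exists>G''\<in>moves (opponent p) G'. iter_zero G''"
  using iter_zero_iff[of G] by blast

lemma iter_zero_gzero: "iter_zero gzero"
  by (simp add: iter_zero_iff[of gzero])

lemma iter_zero_gneg: "iter_zero G \<Longrightarrow> iter_zero (gneg G)"
proof (induction G rule: game_induct_twostep)
  case (options G)
  show ?case
    unfolding iter_zero_iff[of "gneg G"]
  proof (intro allI ballI)
    fix p K assume "K \<in> moves p (gneg G)"
    then obtain G' where G': "G' \<in> moves (opponent p) G" "K = gneg G'"
      by (auto simp: moves_gneg)
    then obtain G'' where "G'' \<in> moves p G'" "iter_zero G''"
      using iter_zeroD[OF options(2)] by fastforce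
    then show "\<exists>K'\<in>moves (opponent p) K. iter_zero K'"
      using options(1) G' by (auto simp: moves_gneg) blast
  qed
qed

text \<open>Mirror strategy: a move in one summand is copied in the other, which leads to G' - G'
  for an option G' of G.\<close>

lemma iter_zero_diff_self: "iter_zero (gplus G (gneg G))"
proof (induction G rule: game_induct)
  case (options G)
  show ?case
    unfolding iter_zero_iff[of "gplus G (gneg G)"]
  proof (intro allI ballI)
    fix p K assume "K \<in> moves p (gplus G (gneg G))"
    then obtain G' q where "G' \<in> moves q G" "K = gplus G' (gneg G) \<or> K = gplus G (gneg G')"
      and "opponent p = q \<and> K = gplus G (gneg G') \<or> p = q \<and> K = gplus G' (gneg G)"
      unfolding moves_gplus moves_gneg by blast
    moreover from this have "gplus G' (gneg G') \<in> moves (opponent p) K"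
      by (auto simp: moves_gplus moves_gneg)
    ultimately have "gplus G' (gneg G') \<in> moves (opponent p) K" "G' \<in> moves q G" by simp_all
    then show "\<exists>K'\<in>moves (opponent p) K. iter_zero K'" using options by blast
  qed
qed

text \<open>Each move is answered in the summand in which it was made. The other summand stays the
  same, so an induction on H is nested in one on G.\<close>

lemma iter_zero_gplus: "iter_zero G \<Longrightarrow> iter_zero H \<Longrightarrow> iter_zero (gplus G H)"
proof (induction G arbitrary: H rule: game_induct_twostep)
  case (options G)
  note outer = options
  show ?case
    using \<open>iter_zero H\<close>
  proof (induction H rule: game_induct_twostep)
    case (options H)
    show ?case
      unfolding iter_zero_iff[of "gplus G H"]
    proof (intro allI ballI)
      fix p K assume "K \<in> moves p (gplus G H)"
      then consider G' where "G' \<in> moves p G" "K = gplus G' H"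
        | H' where "H' \<in> moves p H" "K = gplus G H'"
        by (auto simp: moves_gplus)
      then show "\<exists>K'\<in>moves (opponent p) K. iter_zero K'"
      proof cases
        case (1 G')
        then obtain G'' where "G'' \<in> moves (opponent p) G'" "iter_zero (gplus G'' H)"
          using iter_zeroD[OF outer(2)] outer(1) options(2) by blast
        then show ?thesis using 1 by (auto simp: moves_gplus)
      next
        case (2 H')
        then obtain H'' where "H'' \<in> moves (opponent p) H'" "iter_zero (gplus G H'')"
          using iter_zeroD[OF options(2)] options(1) by blast
        then show ?thesis using 2 by (auto simp: moves_gplus)
      qed
    qed
  qed
qed

text \<open>
  A move in \<open>G\<close> followed by a reply in \<open>H\<close> is answered in \<open>H\<close>, which has to end with a reply
  in \<open>G\<close> because \<open>H\<close> is well-founded.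
\<close>

lemma iter_zero_gplus_cancel: "iter_zero (gplus G H) \<Longrightarrow> iter_zero H \<Longrightarrow> iter_zero G"
proof (induction G arbitrary: H rule: game_induct_twostep)
  case (options G)
  note IH = options(1)
  have reply: "\<exists>G''\<in>moves (opponent p) G'. iter_zero G''"
    if "G' \<in> moves p G" "iter_zero H" "\<exists>K\<in>moves (opponent p) (gplus G' H). iter_zero K" for p G' H
    using that(2,3)
  proof (induction H rule: game_induct_twostep)
    case (options H)
    then consider G'' where "G'' \<in> moves (opponent p) G'" "iter_zero (gplus G'' H)"
      | H' where "H' \<in> moves (opponent p) H" "iter_zero (gplus G' H')"
      by (auto simp: moves_gplus)
    then show ?case
    proof cases
      case (1 G'')
      then show ?thesis using IH that(1) options(2) by blast
    next
      case (2 H')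
      obtain H'' where H'': "H'' \<in> moves p H'" "iter_zero H''"
        using iter_zeroD[OF options(2) 2(1)] by auto
      then have "\<exists>K\<in>moves (opponent p) (gplus G' H''). iter_zero K"
        by (intro iter_zeroD[OF 2(2)]) (simp add: moves_gplus)
      then show ?thesis using options(1)[OF 2(1) H''] by blast
    qed
  qed
  show ?case
    unfolding iter_zero_iff[of G]
  proof (intro allI ballI)
    fix p G' assume G': "G' \<in> moves p G"
    then have "gplus G' H \<in> moves p (gplus G H)" by (simp add: moves_gplus)
    from iter_zeroD[OF options(2) this] show "\<exists>G''\<in>moves (opponent p) G'. iter_zero G''"
      by (rule reply[OF G' options(3)])
  qed
qed

section \<open>Winning positions\<close>

text \<open>Replaces strategies on histories by a recursion on positions. The rule
  \<open>opponent_turn\<close> includes the case in which the opponent cannot move and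
  loses.\<close>

inductive forced_win :: "player \<Rightarrow> player \<Rightarrow> 'g::game_universe \<Rightarrow> bool" for p where
  own_turn: "G' \<in> moves p G \<Longrightarrow> forced_win p (opponent p) G' \<Longrightarrow> forced_win p p G"
| opponent_turn:
    "(\<And>G'. G' \<in> moves (opponent p) G \<Longrightarrow> forced_win p p G') \<Longrightarrow> forced_win p (opponent p) G"

text \<open>A strategy may depend on the past, so the claim is made for every history it can
  produce, with induction on the current position.\<close>

lemma winning_strategy_imp_forced_win:
  assumes "winning_strategy p \<sigma> q G"
  shows "reachable p \<sigma> q G (H # hs) r \<Longrightarrow> forced_win p r H"
proof (induction H arbitrary: hs r rule: game_induct)
  case (options H)
  show ?case
  proof (cases "r = p")
    case True
    then have "\<sigma> (H # hs) \<in> moves p H"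
      using assms options(2) unfolding winning_strategy_def by blast
    moreover from this have "reachable p \<sigma> q G (\<sigma> (H # hs) # H # hs) (opponent p)"
      using options(2) True by (auto intro: reachable.own_move)
    ultimately show ?thesis
      using options(1) True by (auto intro: forced_win.own_turn)
  next
    case False
    then have "r = opponent p" by (cases r; cases p) simp_all
    then show ?thesis
      using options by (blast intro: forced_win.opponent_turn reachable.opponent_move)
  qed
qed

lemma forced_win_imp_wins:
  fixes G :: "'g::game_universe"
  assumes "forced_win p q G"
  shows "wins p q G"
proof -
  \<comment> \<open>This strategy looks only at the current position and picks a move that keeps the
    win forced. That every reachable position is a forced win is the invariant proved below.\<close>
  define \<sigma> where "\<sigma> hs = (SOME K. K \<in> moves p (hd hs) \<and> forced_win p (opponent p) K)" for hs :: "'g list"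
  have \<sigma>: "\<sigma> (H # hs) \<in> moves p H \<and> forced_win p (opponent p) (\<sigma> (H # hs))"
    if "forced_win p p H" for H hs
  proof -
    from that have "\<exists>K. K \<in> moves p H \<and> forced_win p (opponent p) K"
      by (cases rule: forced_win.cases) auto
    then show ?thesis unfolding \<sigma>_def list.sel by (rule someI_ex)
  qed
  have "forced_win p r (hd hs)" if "reachable p \<sigma> q G hs r" for hs r
    using that
  proof induction
    case start
    then show ?case using assms by simp
  next
    case (own_move H hs)
    then show ?case using \<sigma> by simp
  next
    case (opponent_move H hs K)
    from opponent_move.IH have "forced_win p (opponent p) H" by simp
    then show ?case
      by (cases rule: forced_win.cases) (use opponent_move.hyps in auto)
  qed
  then have "winning_strategy p \<sigma> q G"
    unfolding winning_strategy_def using \<sigma> by force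
  then show ?thesis unfolding wins_def by blast
qed

lemma wins_eq_forced_win: "wins p q G \<longleftrightarrow> forced_win p q G"
proof
  assume "wins p q G"
  then obtain \<sigma> where "winning_strategy p \<sigma> q G" unfolding wins_def by blast
  then show "forced_win p q G"
    by (rule winning_strategy_imp_forced_win) (rule reachable.start)
qed (rule forced_win_imp_wins)

lemma wins_own_turn: "wins p p G \<longleftrightarrow> (\<exists>G'\<in>moves p G. wins p (opponent p) G')"
  unfolding wins_eq_forced_win by (subst forced_win.simps) auto

lemma wins_opponent_turn: "wins p (opponent p) G \<longleftrightarrow> (\<forall>G'\<in>moves (opponent p) G. wins p p G')"
  unfolding wins_eq_forced_win by (subst forced_win.simps) auto

lemma wins_opponent_turnD:
  "wins p (opponent p) G \<Longrightarrow> G' \<in> moves (opponent p) G \<Longrightarrow> \<exists>G''\<in>moves p G'. wins p (opponent p) G''"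
  using wins_opponent_turn[of p G] wins_own_turn[of p G'] by blast

lemma wins_opponent_turnI:
  "(\<And>G'. G' \<in> moves (opponent p) G \<Longrightarrow> \<exists>G''\<in>moves p G'. wins p (opponent p) G'') \<Longrightarrow> wins p (opponent p) G"
  by (simp add: wins_opponent_turn[of p G] wins_own_turn[of p])

text \<open>Plays are finite and one player loses each of them: the turn rules of the two players
  are negations of each other, applied inductively.\<close>

lemma wins_determined: "wins (opponent p) q G \<longleftrightarrow> \<not> wins p q G"
proof (induction G arbitrary: p q rule: game_induct)
  case (options G)
  show ?case
  proof (cases "q = p")
    case True
    then show ?thesis
      using options wins_opponent_turn[of "opponent p" G] wins_own_turn[of p G] by auto
  next
    case False
    then have "q = opponent p" by (cases q; cases p) simp_all
    then show ?thesis
      using options wins_opponent_turn[of p G] wins_own_turn[of "opponent p" G] by auto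
  qed
qed

lemma wins_gneg: "wins p q (gneg G) \<longleftrightarrow> wins (opponent p) (opponent q) G"
proof (induction G arbitrary: p q rule: game_induct)
  case (options G)
  show ?case
  proof (cases "q = p")
    case True
    then show ?thesis
      using options wins_own_turn[of p "gneg G"] wins_own_turn[of "opponent p" G]
      by (auto simp: moves_gneg)
  next
    case False
    then have "q = opponent p" by (cases q; cases p) simp_all
    then show ?thesis
      using options wins_opponent_turn[of p "gneg G"] wins_opponent_turn[of "opponent p" G]
      by (auto simp: moves_gneg)
  qed
qed

text \<open>The replies that witness \<open>iter_zero\<close> form a winning strategy for whoever
  moves second.\<close>

lemma iter_zero_imp_wins: "iter_zero G \<Longrightarrow> wins p (opponent p) G"
proof (induction G rule: game_induct_twostep)
  case (options G)
  show ?case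
  proof (rule wins_opponent_turnI)
    fix G' assume "G' \<in> moves (opponent p) G"
    then show "\<exists>G''\<in>moves p G'. wins p (opponent p) G''"
      using iter_zeroD[OF options(2)] options(1) by fastforce
  qed
qed

lemma wins_gplus: "wins p (opponent p) G \<Longrightarrow> wins p (opponent p) H \<Longrightarrow> wins p (opponent p) (gplus G H)"
proof (induction G arbitrary: H rule: game_induct_twostep)
  case (options G)
  note outer = options
  show ?case
    using outer(3)
  proof (induction H rule: game_induct_twostep)
    case (options H)
    show ?case
    proof (rule wins_opponent_turnI)
      fix K assume "K \<in> moves (opponent p) (gplus G H)"
      then consider G' where "G' \<in> moves (opponent p) G" "K = gplus G' H"
        | H' where "H' \<in> moves (opponent p) H" "K = gplus G H'"
        by (auto simp: moves_gplus)
      then show "\<exists>K'\<in>moves p K. wins p (opponent p) K'"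
      proof cases
        case (1 G')
        then obtain G'' where "G'' \<in> moves p G'" "wins p (opponent p) (gplus G'' H)"
          using wins_opponent_turnD[OF outer(2)] outer(1) options(2) by blast
        then show ?thesis using 1 by (auto simp: moves_gplus)
      next
        case (2 H')
        then obtain H'' where "H'' \<in> moves p H'" "wins p (opponent p) (gplus G H'')"
          using wins_opponent_turnD[OF options(2)] options(1) by blast
        then show ?thesis using 2 by (auto simp: moves_gplus)
      qed
    qed
  qed
qed

text \<open>The argument of \<open>iter_zero_gplus_cancel\<close> for one player: when
  \<open>p\<close> replies in H, the opponent restores an iteratively zero H, and after finitely
  many such exchanges \<open>p\<close> has to reply in the first summand. This is what makes the
  order well defined modulo \<open>\<equiv>\<^sub>i\<close>.\<close>

lemma wins_gplus_cancel: "wins p (opponent p) (gplus G H) \<Longrightarrow> iter_zero H \<Longrightarrow> wins p (opponent p) G"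
proof (induction G arbitrary: H rule: game_induct_twostep)
  case (options G)
  note IH = options(1)
  have reply: "\<exists>G''\<in>moves p G'. wins p (opponent p) G''"
    if "G' \<in> moves (opponent p) G" "iter_zero H" "\<exists>K\<in>moves p (gplus G' H). wins p (opponent p) K"
    for G' H
    using that(2,3)
  proof (induction H rule: game_induct_twostep)
    case (options H)
    then consider G'' where "G'' \<in> moves p G'" "wins p (opponent p) (gplus G'' H)"
      | H' where "H' \<in> moves p H" "wins p (opponent p) (gplus G' H')"
      by (auto simp: moves_gplus)
    then show ?case
    proof cases
      case (1 G'')
      then show ?thesis using IH that(1) options(2) by blast
    next
      case (2 H')
      obtain H'' where H'': "H'' \<in> moves (opponent p) H'" "iter_zero H''"
        using iter_zeroD[OF options(2) 2(1)] by auto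
      then have "\<exists>K\<in>moves p (gplus G' H''). wins p (opponent p) K"
        by (intro wins_opponent_turnD[OF 2(2)]) (simp add: moves_gplus)
      then show ?thesis using options(1)[OF 2(1) H''] by blast
    qed
  qed
  show ?case
  proof (rule wins_opponent_turnI)
    fix G' assume G': "G' \<in> moves (opponent p) G"
    then have "gplus G' H \<in> moves (opponent p) (gplus G H)" by (simp add: moves_gplus)
    from wins_opponent_turnD[OF options(2) this] show "\<exists>G''\<in>moves p G'. wins p (opponent p) G''"
      by (rule reply[OF G' options(3)])
  qed
qed

section \<open>The additive group of games modulo iterative equivalence\<close>

lemma gneg_gminus: "gneg (gminus G H) = gminus H G"
  by (simp add: gminus_def gneg_gplus gplus_commute)

text \<open>As forms, (G - H) + (H - K) is (G - K) + (H - H), and the mirror game H - H can be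
  cancelled.\<close>

lemma iter_zero_gminus_trans:
  assumes "iter_zero (gminus G H)" "iter_zero (gminus H K)"
  shows "iter_zero (gminus G K)"
proof (rule iter_zero_gplus_cancel)
  have "gplus (gminus G H) (gminus H K) = gplus (gplus G (gneg H)) (gplus H (gneg K))"
    by (simp add: gminus_def)
  also have "\<dots> = gplus (gminus G K) (gplus H (gneg H))"
    by (metis gminus_def gplus_assoc gplus_commute)
  finally show "iter_zero (gplus (gminus G K) (gplus H (gneg H)))"
    using iter_zero_gplus[OF assms] by simp
qed (rule iter_zero_diff_self)

lemma equiv_iter_eq: "equiv UNIV iter_eq"
proof (rule equivI)
  show "refl iter_eq"
    by (rule refl_onI) (simp_all add: iter_eq_def gminus_def iter_zero_diff_self)
  show "sym iter_eq"
    by (rule symI) (metis (mono_tags) CollectD CollectI case_prodD case_prodI gneg_gminus iter_eq_def iter_zero_gneg)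
  show "trans iter_eq"
    by (rule transI) (auto simp: iter_eq_def intro: iter_zero_gminus_trans)
qed simp

quotient_type (overloaded) 'g igame = "'g::game_universe" / "\<lambda>G H. (G, H) \<in> iter_eq"
  morphisms rep_igame igame
  using equiv_iter_eq by (auto intro!: equivpI reflpI sympI transpI elim!: equivE dest: symD transD refl_onD)

lemma igame_eq_iff: "igame G = igame H \<longleftrightarrow> iter_zero (gminus G H)"
  by (simp add: igame.abs_eq_iff iter_eq_def)

instantiation igame :: (game_universe) ab_group_add
begin

lift_definition zero_igame :: "'a igame" is gzero .

lift_definition uminus_igame :: "'a igame \<Rightarrow> 'a igame" is gneg
  by (simp add: iter_eq_def gminus_def flip: gneg_gplus) (rule iter_zero_gneg)

lift_definition plus_igame :: "'a igame \<Rightarrow> 'a igame \<Rightarrow> 'a igame" is gplus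
proof -
  fix G1 G2 H1 H2 :: 'a
  assume "(G1, G2) \<in> iter_eq" "(H1, H2) \<in> iter_eq"
  then have "iter_zero (gplus (gminus G1 G2) (gminus H1 H2))"
    by (auto simp: iter_eq_def intro: iter_zero_gplus)
  also have "gplus (gminus G1 G2) (gminus H1 H2) = gminus (gplus G1 H1) (gplus G2 H2)"
    unfolding gminus_def gneg_gplus by (metis gplus_assoc gplus_commute)
  finally show "(gplus G1 H1, gplus G2 H2) \<in> iter_eq" by (simp add: iter_eq_def)
qed

definition minus_igame :: "'a igame \<Rightarrow> 'a igame \<Rightarrow> 'a igame" where
  "minus_igame x y = x + - y"

instance
proof
  fix x y z :: "'a igame"
  show "x + y + z = x + (y + z)"
    by transfer (metis gplus_assoc equiv_iter_eq UNIV_I eq_equiv_class_iff)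
  show "x + y = y + x"
    by transfer (metis gplus_commute equiv_iter_eq UNIV_I eq_equiv_class_iff)
  show "0 + x = x"
    by transfer (metis gplus_commute gplus_gzero equiv_iter_eq UNIV_I eq_equiv_class_iff)
  show "- x + x = 0"
    by transfer (simp add: iter_eq_def gminus_def, metis gplus_commute iter_zero_diff_self)
  show "x - y = x + - y" by (rule minus_igame_def)
qed

end

lemma igame_gzero: "igame gzero = 0"
  by (simp add: zero_igame_def)

lemma igame_gplus: "igame (gplus G H) = igame G + igame H"
  by (simp add: plus_igame.abs_eq)

lemma igame_gneg: "igame (gneg G) = - igame G"
  by (simp add: uminus_igame.abs_eq)

lemma igame_gminus: "igame (gminus G H) = igame G - igame H"
  by (simp add: gminus_def igame_gplus igame_gneg)

lemmas igame_simps = igame_gzero igame_gplus igame_gneg igame_gminus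

lemma igame_eq_0_iff: "igame G = 0 \<longleftrightarrow> iter_zero G"
  by (simp add: igame_eq_iff gminus_def flip: igame_gzero)

text \<open>A move in one component of G - H is answered by the matching option in the other
  component. This sufficient condition carries all the ring laws of the product that are proved by
  comparing options.\<close>

lemma igame_eqI:
  assumes "\<And>p G'. G' \<in> moves p G \<Longrightarrow> \<exists>H'\<in>moves p H. igame G' = igame H'"
    and "\<And>p H'. H' \<in> moves p H \<Longrightarrow> \<exists>G'\<in>moves p G. igame G' = igame H'"
  shows "igame G = igame H"
  unfolding igame_eq_iff iter_zero_iff[of "gminus G H"]
proof (intro allI ballI)
  fix p K assume "K \<in> moves p (gminus G H)"
  then consider G' where "G' \<in> moves p G" "K = gplus G' (gneg H)"
    | H' where "H' \<in> moves (opponent p) H" "K = gplus G (gneg H')"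
    by (auto simp: gminus_def moves_gplus moves_gneg)
  then show "\<exists>K'\<in>moves (opponent p) K. iter_zero K'"
  proof cases
    case (1 G')
    then obtain H' where "H' \<in> moves p H" "iter_zero (gplus G' (gneg H'))"
      using assms(1) by (auto simp: igame_eq_iff gminus_def)
    then show ?thesis using 1 by (auto simp: moves_gplus moves_gneg)
  next
    case (2 H')
    then obtain G' where "G' \<in> moves (opponent p) G" "iter_zero (gplus G' (gneg H'))"
      using assms(2) by (auto simp: igame_eq_iff gminus_def)
    then show ?thesis using 2 by (auto simp: moves_gplus moves_gneg)
  qed
qed

section \<open>Multiplication modulo iterative equivalence\<close>

lemma moves_gtimesI:
  assumes "G' \<in> moves a G" "H' \<in> moves b H" "p = Left \<longleftrightarrow> a = b"
  shows "\<exists>K\<in>moves p (gtimes G H).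
    igame K = igame (gtimes G' H) + igame (gtimes G H') - igame (gtimes G' H')"
  using assms by (intro bexI[of _ "gminus (gplus (gtimes G' H) (gtimes G H')) (gtimes G' H')"])
    (auto simp: igame_simps moves_gtimes)

lemma moves_gtimesE:
  assumes "K \<in> moves p (gtimes G H)"
  obtains a b G' H' where "G' \<in> moves a G" "H' \<in> moves b H" "p = Left \<longleftrightarrow> a = b"
    "igame K = igame (gtimes G' H) + igame (gtimes G H') - igame (gtimes G' H')"
  using assms by (auto simp: moves_gtimes igame_simps)

lemma moves_gplusI:
  "G' \<in> moves p G \<Longrightarrow> gplus G' H \<in> moves p (gplus G H)"
  "H' \<in> moves p H \<Longrightarrow> gplus G H' \<in> moves p (gplus G H)"
  by (simp_all add: moves_gplus)

lemma moves_gplusE: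
  assumes "K \<in> moves p (gplus G H)"
  obtains G' where "G' \<in> moves p G" "K = gplus G' H" | H' where "H' \<in> moves p H" "K = gplus G H'"
  using assms by (auto simp: moves_gplus)

lemma igame_gtimes_commute: "igame (gtimes G H) = igame (gtimes H G)"
proof (induction G H rule: game_induct2)
  case (options G H)
  show ?case
  proof (rule igame_eqI)
    fix p K assume "K \<in> moves p (gtimes G H)"
    then show "\<exists>L\<in>moves p (gtimes H G). igame K = igame L"
    proof (cases rule: moves_gtimesE)
      case (1 a b G' H')
      then have "igame K = igame (gtimes H' G) + igame (gtimes H G') - igame (gtimes H' G')"
        by (simp add: options(1)[OF 1(1)] options(2)[OF 1(2)])
      moreover have "p = Left \<longleftrightarrow> b = a" using 1(3) by auto
      ultimately show ?thesis using moves_gtimesI[OF 1(2,1)] by metis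
    qed
  next
    fix p K assume "K \<in> moves p (gtimes H G)"
    then show "\<exists>L\<in>moves p (gtimes G H). igame L = igame K"
    proof (cases rule: moves_gtimesE)
      case (1 b a H' G')
      then have "igame K = igame (gtimes G' H) + igame (gtimes G H') - igame (gtimes G' H')"
        by (simp add: options(1)[OF 1(2)] options(2)[OF 1(1)])
      moreover have "p = Left \<longleftrightarrow> a = b" using 1(3) by auto
      ultimately show ?thesis using moves_gtimesI[OF 1(2,1)] by metis
    qed
  qed
qed

text \<open>For an option G' of G, the option (G' + H)K + (G + H)K' - (G' + H)K' reduces by the
  induction hypotheses to (G'K + GK' - G'K') + HK once HK' cancels. The inner statement keeps the
  right side a single game, because \<open>igame_eqI\<close> needs its options.\<close>

lemma igame_gtimes_gplus_left:
  "igame (gtimes (gplus G H) K) = igame (gtimes G K) + igame (gtimes H K)"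
proof -
  have "igame (gtimes (gplus G H) K) = igame (gplus (gtimes G K) (gtimes H K))"
  proof (induction G H K rule: game_induct3)
    case (options G H K)
    note IH = options[unfolded igame_gplus]
    show ?case
    proof (rule igame_eqI)
      fix p X assume "X \<in> moves p (gtimes (gplus G H) K)"
      then show "\<exists>Y\<in>moves p (gplus (gtimes G K) (gtimes H K)). igame X = igame Y"
      proof (cases rule: moves_gtimesE)
        case (1 a b M K')
        from 1(1) show ?thesis
        proof (cases rule: moves_gplusE)
          case (1 G')
          obtain Y where "Y \<in> moves p (gtimes G K)"
            "igame Y = igame (gtimes G' K) + igame (gtimes G K') - igame (gtimes G' K')"
            using moves_gtimesI[OF 1(1) \<open>K' \<in> moves b K\<close> \<open>(p = Left) = (a = b)\<close>] by blast
          then show ?thesis using \<open>igame X = _\<close> 1 \<open>K' \<in> moves b K\<close>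
            by (intro bexI[OF _ moves_gplusI(1)[of Y]]) (simp_all add: igame_gplus IH)
        next
          case (2 H')
          obtain Y where "Y \<in> moves p (gtimes H K)"
            "igame Y = igame (gtimes H' K) + igame (gtimes H K') - igame (gtimes H' K')"
            using moves_gtimesI[OF 2(1) \<open>K' \<in> moves b K\<close> \<open>(p = Left) = (a = b)\<close>] by blast
          then show ?thesis using \<open>igame X = _\<close> 2 \<open>K' \<in> moves b K\<close>
            by (intro bexI[OF _ moves_gplusI(2)[of Y]]) (simp_all add: igame_gplus IH)
        qed
      qed
    next
      fix p X assume "X \<in> moves p (gplus (gtimes G K) (gtimes H K))"
      then show "\<exists>Y\<in>moves p (gtimes (gplus G H) K). igame Y = igame X"
      proof (cases rule: moves_gplusE)
        case (1 Y)
        from 1(1) show ?thesis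
        proof (cases rule: moves_gtimesE)
          case (1 a b G' K')
          then show ?thesis
            using moves_gtimesI[OF moves_gplusI(1)[OF 1(1), of H] 1(2,3)] \<open>X = _\<close>
            by (auto simp: igame_gplus IH elim!: rev_bexI)
        qed
      next
        case (2 Y)
        from 2(1) show ?thesis
        proof (cases rule: moves_gtimesE)
          case (1 a b H' K')
          then show ?thesis
            using moves_gtimesI[OF moves_gplusI(2)[OF 1(1), of G] 1(2,3)] \<open>X = _\<close>
            by (auto simp: igame_gplus IH elim!: rev_bexI)
        qed
      qed
    qed
  qed
  then show ?thesis by (simp add: igame_gplus)
qed

text \<open>After the move to G'H + GH' - G'H', the opponent answers in the summand G'H with the
  same H' and an iteratively zero option G'' of G'. Both terms G'H' cancel and G''H + GH' - G''H' is
  left, each term of which vanishes by induction.\<close>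

lemma igame_gtimes_iter_zero: "iter_zero G \<Longrightarrow> igame (gtimes G H) = 0"
proof (induction G arbitrary: H rule: game_induct_twostep)
  case (options G H)
  note IH = options(1) and G = \<open>iter_zero G\<close>
  show ?case
  proof (induction H rule: game_induct)
    case (options H)
    show ?case
      unfolding igame_eq_0_iff iter_zero_iff[of "gtimes G H"]
    proof (intro allI ballI)
      fix p K assume "K \<in> moves p (gtimes G H)"
      then obtain a b G' H' where 1: "G' \<in> moves a G" "H' \<in> moves b H" "p = Left \<longleftrightarrow> a = b"
        and K: "K = gplus (gplus (gtimes G' H) (gtimes G H')) (gneg (gtimes G' H'))"
        by (auto simp: moves_gtimes gminus_def)
      obtain G'' where G'': "G'' \<in> moves (opponent a) G'" "iter_zero G''"
        using iter_zeroD[OF G 1(1)] by blast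
      have "opponent p = Left \<longleftrightarrow> opponent a = b"
        using 1(3) by (cases p; cases a; cases b) simp_all
      then obtain L where "L \<in> moves (opponent p) (gtimes G' H)"
        and L: "igame L = igame (gtimes G'' H) + igame (gtimes G' H') - igame (gtimes G'' H')"
        using moves_gtimesI[OF G''(1) 1(2)] by blast
      then have "gplus (gplus L (gtimes G H')) (gneg (gtimes G' H')) \<in> moves (opponent p) K"
        by (simp add: K moves_gplus)
      moreover have "igame (gplus (gplus L (gtimes G H')) (gneg (gtimes G' H'))) = 0"
        using IH[OF 1(1) G''] options[OF 1(2)] by (simp add: L igame_simps)
      ultimately show "\<exists>K'\<in>moves (opponent p) K. iter_zero K'"
        unfolding igame_eq_0_iff by blast
    qed
  qed
qed

lemma igame_gtimes_gneg_left: "igame (gtimes (gneg G) H) = - igame (gtimes G H)"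
proof -
  have "igame (gtimes G H) + igame (gtimes (gneg G) H) = 0"
    by (simp add: igame_gtimes_iter_zero iter_zero_diff_self flip: igame_gtimes_gplus_left)
  then show ?thesis by (simp add: eq_neg_iff_add_eq_0 add.commute)
qed

text \<open>Distributivity reduces well-definedness of the product to the case of an iteratively
  zero factor G - G'.\<close>

lemma igame_gtimes_cong_left:
  assumes "igame G = igame G'"
  shows "igame (gtimes G H) = igame (gtimes G' H)"
proof -
  have "igame (gtimes G H) - igame (gtimes G' H) = igame (gtimes (gminus G G') H)"
    by (simp add: gminus_def igame_gtimes_gplus_left igame_gtimes_gneg_left)
  also have "\<dots> = 0"
    using assms by (intro igame_gtimes_iter_zero) (simp add: igame_eq_iff)
  finally show ?thesis by simp
qed

instantiation igame :: (game_universe) comm_ring_1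
begin

lift_definition times_igame :: "'a igame \<Rightarrow> 'a igame \<Rightarrow> 'a igame" is gtimes
proof -
  fix G1 G2 H1 H2 :: 'a
  assume "(G1, G2) \<in> iter_eq" "(H1, H2) \<in> iter_eq"
  then have "igame G1 = igame G2" "igame H1 = igame H2" by (simp_all add: igame.abs_eq_iff)
  then have "igame (gtimes G1 H1) = igame (gtimes G2 H2)"
    by (metis igame_gtimes_commute igame_gtimes_cong_left)
  then show "(gtimes G1 H1, gtimes G2 H2) \<in> iter_eq" by (simp add: igame.abs_eq_iff)
qed

lift_definition one_igame :: "'a igame" is gone .

lemma igame_gtimes: "igame (gtimes G H) = igame G * igame H"
  by (simp add: times_igame.abs_eq)

lemma igame_gone: "igame gone = 1"
  by (simp add: one_igame_def)

lemma igame_cases: obtains G where "x = igame G"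
  using Quotient_abs_rep[OF Quotient_igame] by metis

instance
proof
  fix x y z :: "'a igame"
  obtain G H K where x: "x = igame G" and y: "y = igame H" and z: "z = igame K"
    by (metis igame_cases)
  show commute: "x * y = y * x" for x y :: "'a igame"
    by (cases x rule: igame_cases, cases y rule: igame_cases)
      (metis igame_gtimes igame_gtimes_commute)
  show distrib: "(x + y) * z = x * z + y * z" for x y z :: "'a igame"
    by (cases x rule: igame_cases, cases y rule: igame_cases, cases z rule: igame_cases)
      (simp add: igame_gtimes_gplus_left flip: igame_gtimes igame_gplus)
  have distrib': "z * (x + y) = z * x + z * y" for x y z :: "'a igame"
    by (metis commute distrib)
  have distribs: "(x - y) * z = x * z - y * z" "z * (x - y) = z * x - z * y"
    for x y z :: "'a igame"
    by (metis distrib distrib' add_diff_cancel_right' diff_add_cancel)+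
  note distribs = distrib distrib' distribs
  \<comment> \<open>An option on either side is the triple product minus (G - G')(H - H')(K - K'),
    and its owner depends only on the parity of the three players; this dictates the matching
    option. Only distributivity is available so far, so both options are expanded into triple
    products, each containing an option of some factor and hence reassociated by an induction
    hypothesis.\<close>
  have "igame (gtimes (gtimes G H) K) = igame (gtimes G (gtimes H K))"
  proof (induction G H K rule: game_induct3)
    case (options G H K)
    note IH = options[unfolded igame_gtimes]
    show ?case
    proof (rule igame_eqI)
      fix p X assume "X \<in> moves p (gtimes (gtimes G H) K)"
      then show "\<exists>Y\<in>moves p (gtimes G (gtimes H K)). igame X = igame Y"
      proof (cases rule: moves_gtimesE)
        case M: (1 d c M K')
        from M(1) show ?thesis
        proof (cases rule: moves_gtimesE)
          case (1 a b G' H')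
          obtain e where e: "e = Left \<longleftrightarrow> b = c" by (metis player.distinct(1))
          obtain N where N: "N \<in> moves e (gtimes H K)"
            "igame N = igame (gtimes H' K) + igame (gtimes H K') - igame (gtimes H' K')"
            using moves_gtimesI[OF 1(2) M(2), of e] e by blast
          have "p = Left \<longleftrightarrow> a = e"
            using 1(3) M(3) e by (cases a; cases b; cases c; cases d; cases e) simp_all
          then obtain Y where "Y \<in> moves p (gtimes G (gtimes H K))"
            "igame Y = igame (gtimes G' (gtimes H K)) + igame (gtimes G N) - igame (gtimes G' N)"
            using moves_gtimesI[OF 1(1) N(1)] by blast
          moreover from this have "igame X = igame Y"
            by (simp only: M(4) N(2) 1(4) igame_gtimes distribs IH(1)[OF 1(1)] IH(2)[OF 1(2)] IH(3)[OF M(2)])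
              (simp add: algebra_simps)
          ultimately show ?thesis by blast
        qed
      qed
    next
      fix p X assume "X \<in> moves p (gtimes G (gtimes H K))"
      then show "\<exists>Y\<in>moves p (gtimes (gtimes G H) K). igame Y = igame X"
      proof (cases rule: moves_gtimesE)
        case N: (1 a d G' N)
        from N(2) show ?thesis
        proof (cases rule: moves_gtimesE)
          case (1 b c H' K')
          obtain e where e: "e = Left \<longleftrightarrow> a = b" by (metis player.distinct(1))
          obtain M where M: "M \<in> moves e (gtimes G H)"
            "igame M = igame (gtimes G' H) + igame (gtimes G H') - igame (gtimes G' H')"
            using moves_gtimesI[OF N(1) 1(1), of e] e by blast
          have "p = Left \<longleftrightarrow> e = c"
            using 1(3) N(3) e by (cases a; cases b; cases c; cases d; cases e) simp_all
          then obtain Y where "Y \<in> moves p (gtimes (gtimes G H) K)"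
            "igame Y = igame (gtimes M K) + igame (gtimes (gtimes G H) K') - igame (gtimes M K')"
            using moves_gtimesI[OF M(1) 1(2)] by blast
          moreover from this have "igame Y = igame X"
            by (simp only: N(4) M(2) 1(4) igame_gtimes distribs IH(1)[OF N(1)] IH(2)[OF 1(1)] IH(3)[OF 1(2)])
              (simp add: algebra_simps)
          ultimately show ?thesis by blast
        qed
      qed
    qed
  qed
  then show "x * y * z = x * (y * z)" by (simp add: x y z igame_gtimes)
  \<comment> \<open>The only option of 1 is the Left option 0, so the options of G1 are G'1 + G0 -
    G'0, owned by the player who moved to G'.\<close>
  have "igame (gtimes G gone) = igame G"
  proof (induction G rule: game_induct)
    case (options G)
    have gzero: "igame (gtimes L gzero) = 0" for L :: 'a
      by (metis igame_gtimes_commute igame_gtimes_iter_zero iter_zero_gzero)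
    show ?case
    proof (rule igame_eqI)
      fix p X assume "X \<in> moves p (gtimes G gone)"
      then show "\<exists>Y\<in>moves p G. igame X = igame Y"
        by (rule moves_gtimesE)
          (use options in \<open>auto simp: moves_gone gzero split: if_splits\<close>, (metis player.exhaust)+)
    next
      fix p Y assume Y: "Y \<in> moves p G"
      have "\<exists>X\<in>moves p (gtimes G gone). igame X =
        igame (gtimes Y gone) + igame (gtimes G gzero) - igame (gtimes Y gzero)"
        by (rule moves_gtimesI[OF Y, of _ Left]) (simp_all add: moves_gone)
      then show "\<exists>X\<in>moves p (gtimes G gone). igame X = igame Y"
        using options[OF Y] by (simp add: gzero)
    qed
  qed
  then have "x * 1 = x" by (simp add: x igame_gtimes igame_gone)
  then show "1 * x = x" by (simp add: commute)
  have "\<not> iter_zero (gone :: 'a)"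
    using iter_zeroD[of "gone :: 'a" gzero Left] by (auto simp: moves_gone)
  then show "(0 :: 'a igame) \<noteq> 1" by (metis igame_eq_0_iff igame_gone)
qed

end

lemmas igame_ring_simps = igame_simps igame_gtimes igame_gone

section \<open>Order and numbers\<close>

text \<open>Adding the iteratively zero H - G to G gives the form H + (G - G), from which the mirror
  game is cancelled.\<close>

lemma wins_iter_zero_gminus:
  assumes "wins p (opponent p) G" "iter_zero (gminus G H)"
  shows "wins p (opponent p) H"
proof (rule wins_gplus_cancel)
  have "iter_zero (gminus H G)" using iter_zero_gneg[OF assms(2)] by (simp add: gneg_gminus)
  then have "wins p (opponent p) (gplus G (gminus H G))"
    by (intro wins_gplus assms(1) iter_zero_imp_wins)
  also have "gplus G (gminus H G) = gplus H (gplus G (gneg G))"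
    unfolding gminus_def by (metis gplus_assoc gplus_commute)
  finally show "wins p (opponent p) (gplus H (gplus G (gneg G)))" .
qed (rule iter_zero_diff_self)

text \<open>Conway's relation G >= 0. Accordingly \<open>pos\<close> is G > 0 and
  \<open>null\<close> is Conway equivalence to 0.\<close>

lift_definition nonneg :: "'g::game_universe igame \<Rightarrow> bool" is "wins Left Right"
proof -
  fix G H :: 'g
  assume "(G, H) \<in> iter_eq"
  then have "iter_zero (gminus G H)" by (simp add: iter_eq_def)
  moreover from this have "iter_zero (gminus H G)" by (metis gneg_gminus iter_zero_gneg)
  ultimately show "wins Left Right G = wins Left Right H"
    using wins_iter_zero_gminus[of Left] by auto
qed

lemma nonneg_igame: "nonneg (igame G) \<longleftrightarrow> wins Left Right G"
  by (simp add: nonneg.abs_eq)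

definition pos :: "'g::game_universe igame \<Rightarrow> bool" where
  "pos x \<longleftrightarrow> nonneg x \<and> \<not> nonneg (- x)"

definition null :: "'g::game_universe igame \<Rightarrow> bool" where
  "null x \<longleftrightarrow> nonneg x \<and> nonneg (- x)"

lemma nonneg_0: "nonneg 0"
  using iter_zero_imp_wins[OF iter_zero_gzero, of Left] by (simp add: nonneg_igame flip: igame_gzero)

lemma nonneg_add: "nonneg x \<Longrightarrow> nonneg y \<Longrightarrow> nonneg (x + y)"
proof (cases x rule: igame_cases, cases y rule: igame_cases)
  fix G H assume "nonneg x" "nonneg y" "x = igame G" "y = igame H"
  then show "nonneg (x + y)"
    using wins_gplus[of Left G H] by (simp add: nonneg_igame flip: igame_gplus)
qed

lemma pos_add_nonneg: "pos x \<Longrightarrow> nonneg y \<Longrightarrow> pos (x + y)"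
  unfolding pos_def using nonneg_add[of x y] nonneg_add[of "- (x + y)" y] by auto

lemma pos_imp_nonneg: "pos x \<Longrightarrow> nonneg x"
  by (simp add: pos_def)

lemma null_imp_nonneg: "null x \<Longrightarrow> nonneg x"
  by (simp add: null_def)

lemma pos_add: "pos x \<Longrightarrow> pos y \<Longrightarrow> pos (x + y)"
  by (intro pos_add_nonneg pos_imp_nonneg)

lemma null_0: "null 0"
  by (simp add: null_def nonneg_0)

lemma null_uminus [simp]: "null (- x) \<longleftrightarrow> null x"
  by (auto simp: null_def)

lemma null_add: "null x \<Longrightarrow> null y \<Longrightarrow> null (x + y)"
  unfolding null_def using nonneg_add[of x y] nonneg_add[of "- x" "- y"] by simp

lemma null_diff: "null x \<Longrightarrow> null y \<Longrightarrow> null (x - y)"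
  using null_add[of x "- y"] by simp

lemma nonneg_cases: "nonneg x \<Longrightarrow> pos x \<or> null x"
  by (auto simp: pos_def null_def)

text \<open>A factor \<open>sign p\<close> turns a statement about Left into its mirror image for
  Right, so inequalities are argued once for both players.\<close>

fun sign :: "player \<Rightarrow> 'a::comm_ring_1" where
  "sign Left = 1"
| "sign Right = - 1"

lemma sign_opponent [simp]: "sign (opponent p) = - sign p"
  by (cases p) simp_all

lemma null_sign_mult [simp]: "null (sign p * x) \<longleftrightarrow> null x"
  by (cases p) simp_all

lemma nonneg_sign_igame: "nonneg (sign p * igame G) \<longleftrightarrow> wins p (opponent p) G"
  by (cases p) (simp_all add: nonneg_igame wins_gneg flip: igame_gneg)

text \<open>Conway's recursive definition of the order: G >= 0 exactly if no Right option is <= 0.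
  Determinacy supplies the negation.\<close>

lemma nonneg_sign_igame_iff:
  fixes G :: "'g::game_universe"
  shows "nonneg (sign p * igame G) \<longleftrightarrow> (\<forall>G'\<in>moves (opponent p) G. \<not> nonneg (- (sign p * igame G')))"
proof -
  have "nonneg (- (sign p * igame G')) \<longleftrightarrow> \<not> wins p p G'" for G' :: 'g
    using nonneg_sign_igame[of "opponent p" G'] wins_determined[of p p G'] by simp
  then show ?thesis
    using wins_opponent_turn[of p G] by (simp add: nonneg_sign_igame)
qed

lemma conway_zero_iff: "conway_zero G \<longleftrightarrow> null (igame G)"
  by (simp add: conway_zero_def null_def all_player nonneg_igame wins_gneg conj_commute flip: igame_gneg)

lemma gless_iff: "gless H G \<longleftrightarrow> pos (igame G - igame H)"
  using wins_determined[of Right Left "gminus G H"]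
  by (simp add: gless_def pos_def all_player nonneg_igame wins_gneg conj_commute flip: igame_gneg igame_gminus)

section \<open>Numbers and their additive closure\<close>

lemma number_iff:
  "number G \<longleftrightarrow> (\<forall>p. \<forall>G'\<in>moves p G. number G') \<and>
     (\<forall>GL\<in>moves Left G. \<forall>GR\<in>moves Right G. pos (igame GR - igame GL))" (is "_ \<longleftrightarrow> ?opts \<and> ?lt")
proof
  assume G: "number G"
  have "(H, G) \<in> option_rel\<^sup>*" if "G' \<in> moves p G" "(H, G') \<in> option_rel\<^sup>*" for p G' H
    using that by (cases p) (auto simp: option_rel_def intro: rtrancl_into_rtrancl)
  then have ?opts using G unfolding number_def by blast
  moreover have ?lt using G unfolding number_def gless_iff by auto
  ultimately show "?opts \<and> ?lt" ..
next
  assume *: "?opts \<and> ?lt"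
  show "number G"
    unfolding number_def
  proof (intro allI impI)
    fix H assume "(H, G) \<in> option_rel\<^sup>*"
    then show "\<forall>HL\<in>lefts H. \<forall>HR\<in>rights H. gless HL HR"
    proof (cases rule: rtranclE)
      case base
      then show ?thesis using * by (simp add: gless_iff)
    next
      case (step G')
      then have "number G'" using * by (auto simp: option_rel_def all_player)
      then show ?thesis using step(1) unfolding number_def by blast
    qed
  qed
qed

lemma number_moves: "number G \<Longrightarrow> G' \<in> moves p G \<Longrightarrow> number G'"
  using number_iff[of G] by blast

lemma number_options_less:
  assumes "number G" "G' \<in> moves p G" "G'' \<in> moves (opponent p) G"
  shows "pos (sign p * (igame G'' - igame G'))"
  using assms number_iff[of G] by (cases p) auto

text \<open>For the weak inequality, let the opponent of \<open>p\<close> start on G - G'. A move in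
  G crosses to the opposite options, which lie on the right side of G' because G is a number. A move
  to G - G'', with G'' an option of G' for \<open>p\<close>, is answered by G' - G'', to which the
  induction hypothesis applies. Strictness holds because \<open>p\<close>, starting, can move to G'
  - G'.\<close>

lemma number_option_less: "number G \<Longrightarrow> G' \<in> moves p G \<Longrightarrow> pos (sign p * (igame G - igame G'))"
proof (induction G arbitrary: p G' rule: game_induct)
  case (options G)
  have "nonneg (sign p * igame (gminus G G'))"
    unfolding nonneg_sign_igame_iff
  proof
    fix K assume "K \<in> moves (opponent p) (gminus G G')"
    then consider G'' where "G'' \<in> moves (opponent p) G" "K = gplus G'' (gneg G')"
      | G'' where "G'' \<in> moves p G'" "K = gplus G (gneg G'')"
      by (auto simp: gminus_def moves_gplus moves_gneg)
    then show "\<not> nonneg (- (sign p * igame K))"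
    proof cases
      case (1 G'')
      then show ?thesis
        using number_options_less[OF options(2,3), of G''] by (simp add: igame_simps pos_def)
    next
      case (2 G'')
      let ?K = "gplus G' (gneg G'')"
      have "?K \<in> moves p K" using 2 options(3) by (simp add: moves_gplus)
      moreover have "nonneg (sign p * igame ?K)"
        using options(1)[OF options(3) number_moves[OF options(2,3)] 2(1)]
        by (simp add: igame_simps pos_def)
      ultimately show ?thesis
        using nonneg_sign_igame_iff[of "opponent p" K] by auto
    qed
  qed
  moreover have "\<not> nonneg (- (sign p * igame (gminus G G')))"
  proof -
    have "gminus G' G' \<in> moves p (gminus G G')"
      using options(3) by (simp add: gminus_def moves_gplus)
    moreover have "nonneg (sign p * igame (gminus G' G'))"
      by (simp add: igame_simps nonneg_0)
    ultimately show ?thesis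
      using nonneg_sign_igame_iff[of "opponent p" "gminus G G'"] by auto
  qed
  ultimately show ?case by (simp add: pos_def igame_simps)
qed

text \<open>If G <= 0 fails, some Left option is >= 0, and a number exceeds its Left
  options.\<close>

lemma number_linear:
  assumes "number G"
  shows "nonneg (igame G) \<or> nonneg (- igame G)"
proof (rule disjCI)
  assume "\<not> nonneg (- igame G)"
  show "nonneg (igame G)"
  proof -
    obtain G' where G': "G' \<in> moves Left G" "nonneg (igame G')"
      using \<open>\<not> nonneg (- igame G)\<close> nonneg_sign_igame_iff[of Right G] by auto
    then show ?thesis
      using number_option_less[OF assms G'(1)] nonneg_add[of "igame G'" "igame G - igame G'"]
      by (simp add: pos_def)
  qed
qed

lemma number_gzero: "number gzero"
  by (simp add: number_iff[of gzero])

lemma number_gone: "number gone"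
  by (simp add: number_iff[of gone] moves_gone number_gzero)

lemma number_gneg: "number G \<Longrightarrow> number (gneg G)"
proof (induction G rule: game_induct)
  case (options G)
  then have "number (gneg G')" if "G' \<in> moves p G" for p G'
    using that number_moves by blast
  then show ?case
    using options(2) number_iff[of G] by (auto simp: number_iff[of "gneg G"] moves_gneg igame_gneg)
qed

lemma number_gplus: "number G \<Longrightarrow> number H \<Longrightarrow> number (gplus G H)"
proof (induction G H rule: game_induct2)
  case (options G H)
  note G = \<open>number G\<close> and H = \<open>number H\<close>
  have "number K" if "K \<in> moves p (gplus G H)" for p K
    using that by (rule moves_gplusE) (use options number_moves in blast)+
  moreover have "pos (igame KR - igame KL)"
    if "KL \<in> moves Left (gplus G H)" "KR \<in> moves Right (gplus G H)" for KL KR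
    using that
  proof (elim moves_gplusE)
    fix GL GR assume *: "GL \<in> moves Left G" "GR \<in> moves Right G" and K: "KL = gplus GL H" "KR = gplus GR H"
    then show ?thesis using number_options_less[OF G *(1), of GR] by (simp add: igame_simps)
  next
    fix HL HR assume *: "HL \<in> moves Left H" "HR \<in> moves Right H" and K: "KL = gplus G HL" "KR = gplus G HR"
    then show ?thesis using number_options_less[OF H *(1), of HR] by (simp add: igame_simps)
  next
    fix GL HR assume *: "GL \<in> moves Left G" "HR \<in> moves Right H" and K: "KL = gplus GL H" "KR = gplus G HR"
    then show ?thesis
      using pos_add[OF number_option_less[OF G *(1)] number_option_less[OF H *(2)]]
      by (simp add: igame_simps algebra_simps)
  next
    fix HL GR assume *: "HL \<in> moves Left H" "GR \<in> moves Right G" and K: "KL = gplus G HL" "KR = gplus GR H"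
    then show ?thesis
      using pos_add[OF number_option_less[OF H *(1)] number_option_less[OF G *(2)]]
      by (simp add: igame_simps algebra_simps)
  qed
  ultimately show ?case unfolding number_iff[of "gplus G H"] by blast
qed

lemma number_gminus: "number G \<Longrightarrow> number H \<Longrightarrow> number (gminus G H)"
  unfolding gminus_def by (intro number_gplus number_gneg)

section \<open>The simultaneous induction for products of numbers\<close>

text \<open>The first clause is Conway's inequality (G2 - G1)(H2 - H1) > 0 for G1 < G2 and H1 < H2,
  with the second difference taken between H and one of its options so that the claim involves three
  numbers only. The second clause says that Conway equivalent G1 and G2 have Conway equivalent
  products with H. Allowing both signs \<open>a\<close> makes the statement symmetric in G1 and
  G2.\<close>

definition product_monotone :: "'g::game_universe \<Rightarrow> 'g \<Rightarrow> 'g \<Rightarrow> bool" where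
  "product_monotone G1 G2 H \<longleftrightarrow>
     (\<forall>a b. \<forall>H'\<in>moves b H. pos (sign a * (igame G2 - igame G1)) \<longrightarrow>
        pos (sign a * sign b * ((igame G2 - igame G1) * (igame H - igame H')))) \<and>
     (null (igame G2 - igame G1) \<longrightarrow> null ((igame G2 - igame G1) * igame H))"

lemma product_monotone_sym: "product_monotone G1 G2 H \<Longrightarrow> product_monotone G2 G1 H"
  unfolding product_monotone_def
proof (intro conjI allI ballI impI; elim conjE)
  fix a b H' assume "H' \<in> moves b H" "pos (sign a * (igame G1 - igame G2))"
    and *: "\<forall>a b. \<forall>H'\<in>moves b H. pos (sign a * (igame G2 - igame G1)) \<longrightarrow>
        pos (sign a * sign b * ((igame G2 - igame G1) * (igame H - igame H')))"
  then have "pos (sign (opponent a) * (igame G2 - igame G1))"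
    by (simp add: algebra_simps)
  then have "pos (sign (opponent a) * sign b * ((igame G2 - igame G1) * (igame H - igame H')))"
    using * \<open>H' \<in> moves b H\<close> by blast
  then show "pos (sign a * sign b * ((igame G1 - igame G2) * (igame H - igame H')))"
    by (simp add: algebra_simps)
next
  assume "null (igame G1 - igame G2)"
    and *: "null (igame G2 - igame G1) \<longrightarrow> null ((igame G2 - igame G1) * igame H)"
  then have "null ((igame G2 - igame G1) * igame H)"
    using null_uminus[of "igame G1 - igame G2"] by simp
  then show "null ((igame G1 - igame G2) * igame H)"
    using null_uminus[of "(igame G2 - igame G1) * igame H"] by (simp add: algebra_simps)
qed

text \<open>In the null case the product with H - H' is split into two null products, which is why
  monotonicity is also assumed for H'.\<close>

lemma product_monotone_nonneg:
  assumes "product_monotone G1 G2 H" "product_monotone G1 G2 H'" "H' \<in> moves b H"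
    and "nonneg (sign a * (igame G2 - igame G1))"
  shows "nonneg (sign a * sign b * ((igame G2 - igame G1) * (igame H - igame H')))"
  using nonneg_cases[OF assms(4)]
proof
  assume "pos (sign a * (igame G2 - igame G1))"
  then show ?thesis using assms(1,3) unfolding product_monotone_def by (blast intro: pos_imp_nonneg)
next
  assume "null (sign a * (igame G2 - igame G1))"
  then have "null ((igame G2 - igame G1) * igame H - (igame G2 - igame G1) * igame H')"
    using assms(1,2) by (intro null_diff) (simp_all add: product_monotone_def)
  then show ?thesis
    by (intro null_imp_nonneg) (simp add: mult.assoc flip: right_diff_distrib)
qed

text \<open>The quantity is, up to sign, the difference between GH and one of its options, so it is
  governed by \<open>number_option_less\<close>.\<close>

lemma number_gtimes_option_less:
  assumes "number (gtimes G H)" "G' \<in> moves a G" "H' \<in> moves b H"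
  shows "pos (sign a * sign b * ((igame G - igame G') * (igame H - igame H')))"
proof -
  obtain p where p: "p = Left \<longleftrightarrow> a = b" by (metis player.distinct(1))
  then obtain K where K: "K \<in> moves p (gtimes G H)"
    "igame K = igame (gtimes G' H) + igame (gtimes G H') - igame (gtimes G' H')"
    using moves_gtimesI[OF assms(2,3)] by blast
  have "(igame G - igame G') * (igame H - igame H') = igame (gtimes G H) - igame K"
    by (simp add: K igame_ring_simps algebra_simps)
  moreover have "sign a * sign b = (sign p :: 'a igame)"
    using p by (cases a; cases b; cases p) simp_all
  ultimately show ?thesis using number_option_less[OF assms(1) K(1)] by simp
qed

text \<open>
  Two numbers with \<open>G1 < G2\<close> are separated by a Left option of \<open>G2\<close> or a Right option of \<open>G1\<close>,
  which splits the product into one with fewer positions and one given by an option of a product.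
\<close>

lemma product_monotone_strict_step:
  assumes "number G1" "number G2" "pos (igame G2 - igame G1)" "H' \<in> moves b H"
    and "number (gtimes G1 H)" "number (gtimes G2 H)"
    and G1: "\<And>p K. K \<in> moves p G1 \<Longrightarrow> product_monotone K G2 H \<and> product_monotone K G2 H'"
    and G2: "\<And>p K. K \<in> moves p G2 \<Longrightarrow> product_monotone G1 K H \<and> product_monotone G1 K H'"
  shows "pos (sign b * ((igame G2 - igame G1) * (igame H - igame H')))"
proof -
  \<comment> \<open>Since G1 >= G2 fails, Right can move in G1 - G2 to a position <= 0. A move in G1
    gives a Right option of G1 below or equal to G2, a move in -G2 a Left option of G2 above or
    equal to G1.\<close>
  have "\<not> nonneg (sign Left * igame (gminus G1 G2))"
    using assms(3) by (simp add: igame_simps pos_def)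
  then obtain K where "K \<in> moves Right (gminus G1 G2)" "nonneg (- igame K)"
    unfolding nonneg_sign_igame_iff by auto
  then consider K where "K \<in> moves Right G1" "nonneg (igame G2 - igame K)"
    | K where "K \<in> moves Left G2" "nonneg (igame K - igame G1)"
    by (auto simp: gminus_def moves_gplus moves_gneg igame_simps)
  then show ?thesis
  proof cases
    case (1 K)
    have "pos (sign b * ((igame K - igame G1) * (igame H - igame H')))"
      using number_gtimes_option_less[OF assms(5) 1(1) assms(4)] by (simp add: algebra_simps)
    moreover have "nonneg (sign b * ((igame G2 - igame K) * (igame H - igame H')))"
      using product_monotone_nonneg[of K G2 H H' b Left] G1[OF 1(1)] 1(2) assms(4) by simp
    ultimately have "pos (sign b * ((igame K - igame G1) * (igame H - igame H')) +
        sign b * ((igame G2 - igame K) * (igame H - igame H')))"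
      by (rule pos_add_nonneg)
    then show ?thesis by (simp add: algebra_simps)
  next
    case (2 K)
    have "pos (sign b * ((igame G2 - igame K) * (igame H - igame H')))"
      using number_gtimes_option_less[OF assms(6) 2(1) assms(4)] by (simp add: algebra_simps)
    moreover have "nonneg (sign b * ((igame K - igame G1) * (igame H - igame H')))"
      using product_monotone_nonneg[of G1 K H H' b Left] G2[OF 2(1)] 2(2) assms(4) by simp
    ultimately have "pos (sign b * ((igame G2 - igame K) * (igame H - igame H')) +
        sign b * ((igame K - igame G1) * (igame H - igame H')))"
      by (rule pos_add_nonneg)
    then show ?thesis by (simp add: algebra_simps)
  qed
qed

text \<open>For K built from G' and H', the identity G1 H - K = (G1 - G')(H - H') - (G2 - G1)H'
  holds. The last product is null by the hypothesis for H', and the first has a known sign because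
  G' lies on the same side of G1 as of its Conway equivalent G2.\<close>

lemma null_mult_step:
  assumes "number G2" "null (igame G2 - igame G1)" "K \<in> moves p (gtimes G2 H)"
    and H: "\<And>b H'. H' \<in> moves b H \<Longrightarrow> product_monotone G1 G2 H'"
    and G2: "\<And>a G'. G' \<in> moves a G2 \<Longrightarrow> product_monotone G' G1 H"
  shows "pos (sign p * (igame (gtimes G1 H) - igame K))"
  using assms(3)
proof (rule moves_gtimesE)
  fix a b G' H'
  assume *: "G' \<in> moves a G2" "H' \<in> moves b H" "p = Left \<longleftrightarrow> a = b"
    and K: "igame K = igame (gtimes G' H) + igame (gtimes G2 H') - igame (gtimes G' H')"
  have sign: "sign p = (sign a * sign b :: 'a igame)"
    using *(3) by (cases a; cases b; cases p) simp_all
  have "pos (sign a * (igame G2 - igame G') + - (sign a * (igame G2 - igame G1)))"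
    using number_option_less[OF assms(1) *(1)] assms(2)
    by (intro pos_add_nonneg null_imp_nonneg) simp_all
  then have "pos (sign a * (igame G1 - igame G'))" by (simp add: algebra_simps)
  then have "pos (sign p * ((igame G1 - igame G') * (igame H - igame H')))"
    using G2[OF *(1)] *(2) unfolding product_monotone_def sign by blast
  moreover have "null (- (sign p * ((igame G2 - igame G1) * igame H')))"
    using H[OF *(2)] assms(2) by (simp add: product_monotone_def)
  ultimately have "pos (sign p * ((igame G1 - igame G') * (igame H - igame H')) +
      - (sign p * ((igame G2 - igame G1) * igame H')))"
    by (intro pos_add_nonneg null_imp_nonneg)
  also have "sign p * ((igame G1 - igame G') * (igame H - igame H')) +
      - (sign p * ((igame G2 - igame G1) * igame H')) = sign p * (igame (gtimes G1 H) - igame K)"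
    by (simp add: K igame_gtimes algebra_simps)
  finally show "pos (sign p * (igame (gtimes G1 H) - igame K))" .
qed

text \<open>By the recursive definition of the order, G2 H >= G1 H holds once every Right option of
  G2 H is > G1 H and every Left option of G1 H is < G2 H. Both are instances of
  \<open>null_mult_step\<close>.\<close>

lemma nonneg_mult_step:
  assumes "number G1" "number G2" "null (igame G2 - igame G1)"
    and H: "\<And>b H'. H' \<in> moves b H \<Longrightarrow> product_monotone G1 G2 H'"
    and G1: "\<And>a G'. G' \<in> moves a G1 \<Longrightarrow> product_monotone G' G2 H"
    and G2: "\<And>a G'. G' \<in> moves a G2 \<Longrightarrow> product_monotone G' G1 H"
  shows "nonneg ((igame G2 - igame G1) * igame H)"
proof -
  have "nonneg (sign Left * igame (gminus (gtimes G2 H) (gtimes G1 H)))"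
    unfolding nonneg_sign_igame_iff
  proof
    fix K assume "K \<in> moves (opponent Left) (gminus (gtimes G2 H) (gtimes G1 H))"
    then consider K' where "K' \<in> moves Right (gtimes G2 H)" "K = gplus K' (gneg (gtimes G1 H))"
      | K' where "K' \<in> moves Left (gtimes G1 H)" "K = gplus (gtimes G2 H) (gneg K')"
      by (auto simp: gminus_def moves_gplus moves_gneg)
    then show "\<not> nonneg (- (sign Left * igame K))"
    proof cases
      case (1 K')
      then show ?thesis
        using null_mult_step[OF assms(2,3) 1(1) H G2] by (simp add: igame_simps pos_def)
    next
      case (2 K')
      have "null (igame G1 - igame G2)" using assms(3) null_uminus[of "igame G2 - igame G1"] by simp
      then show ?thesis
        using null_mult_step[OF assms(1) _ 2(1) product_monotone_sym[OF H] G1] 2(2)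
        by (simp add: igame_simps pos_def)
    qed
  qed
  then show ?thesis by (simp add: igame_ring_simps algebra_simps)
qed

lemma product_monotone_step:
  assumes "number G1" "number G2"
    and "number (gtimes G1 H)" "number (gtimes G2 H)"
    and H: "\<And>b H'. H' \<in> moves b H \<Longrightarrow> product_monotone G1 G2 H'"
    and G1: "\<And>p K. K \<in> moves p G1 \<Longrightarrow> product_monotone K G2 H"
    and G1H: "\<And>p K b H'. K \<in> moves p G1 \<Longrightarrow> H' \<in> moves b H \<Longrightarrow> product_monotone K G2 H'"
    and G2: "\<And>p K. K \<in> moves p G2 \<Longrightarrow> product_monotone K G1 H"
    and G2H: "\<And>p K b H'. K \<in> moves p G2 \<Longrightarrow> H' \<in> moves b H \<Longrightarrow> product_monotone K G1 H'"
  shows "product_monotone G1 G2 H"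
proof -
  have "pos (sign a * sign b * ((igame G2 - igame G1) * (igame H - igame H')))"
    if "H' \<in> moves b H" "pos (sign a * (igame G2 - igame G1))" for a b H'
  proof (cases a)
    case Left
    have "pos (sign b * ((igame G2 - igame G1) * (igame H - igame H')))"
      by (rule product_monotone_strict_step[OF assms(1,2) _ that(1) assms(3,4)])
        (use Left that in \<open>auto intro: G1 G1H product_monotone_sym[OF G2] product_monotone_sym[OF G2H]\<close>)
    then show ?thesis using Left by simp
  next
    case Right
    have "pos (sign b * ((igame G1 - igame G2) * (igame H - igame H')))"
      by (rule product_monotone_strict_step[OF assms(2,1) _ that(1) assms(4,3)])
        (use Right that in \<open>auto intro: G2 G2H product_monotone_sym[OF G1] product_monotone_sym[OF G1H]\<close>)
    then show ?thesis using Right by (simp add: algebra_simps)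
  qed
  moreover have "null ((igame G2 - igame G1) * igame H)" if "null (igame G2 - igame G1)"
  proof -
    \<comment> \<open>Null means both inequalities; the second is the first with G1 and G2
      exchanged.\<close>
    have "nonneg ((igame G2 - igame G1) * igame H)"
      by (rule nonneg_mult_step[OF assms(1,2) that H G1 G2])
    moreover have "null (igame G1 - igame G2)" using that null_uminus[of "igame G2 - igame G1"] by simp
    then have "nonneg ((igame G1 - igame G2) * igame H)"
      by (rule nonneg_mult_step[OF assms(2,1) _ product_monotone_sym[OF H] G2 G1])
    ultimately show ?thesis by (simp add: null_def algebra_simps)
  qed
  ultimately show ?thesis unfolding product_monotone_def by blast
qed

text \<open>Write K(G',H') for GH - (G - G')(H - H'). The claim K(G1,H1) < K(G2,H2) is proved
  through an intermediate option, so that only differences of options of one factor occur. If G1 is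
  at least as close to G as G2, then K(G1,H1) < K(G1,H2) <= K(G2,H2). Otherwise K(G1,H1) <= K(G2,H1)
  < K(G2,H2). Linearity for G1 - G2 decides between the cases.\<close>

lemma gtimes_options_less:
  assumes "number G" "number H"
    and opts: "G1 \<in> moves a G" "G2 \<in> moves a G" "H1 \<in> moves a H" "H2 \<in> moves (opponent a) H"
    and mono: "product_monotone H1 H2 G" "product_monotone G1 G2 H" "product_monotone G1 G2 H1" "product_monotone G1 G2 H2"
  shows "pos ((igame G - igame G1) * (igame H - igame H1) - (igame G - igame G2) * (igame H - igame H2))"
proof -
  have H: "pos (sign a * (igame H2 - igame H1))"
    using number_options_less[OF assms(2) opts(3,4)] .
  have "nonneg (igame (gminus G1 G2)) \<or> nonneg (- igame (gminus G1 G2))"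
    using assms(1) opts(1,2) by (intro number_linear number_gminus) (auto intro: number_moves)
  then consider "nonneg (sign a * (igame G1 - igame G2))" | "nonneg (sign a * (igame G2 - igame G1))"
    by (cases a) (auto simp: igame_simps)
  then show ?thesis
  proof cases
    case 1
    have "pos (sign a * sign a * ((igame H2 - igame H1) * (igame G - igame G1)))"
      using mono(1) opts(1) H unfolding product_monotone_def by blast
    moreover have "nonneg (sign a * sign (opponent a) * ((igame G1 - igame G2) * (igame H - igame H2)))"
      using product_monotone_nonneg[OF mono(2,4)[THEN product_monotone_sym] opts(4) 1] .
    ultimately have "pos (sign a * sign a * ((igame H2 - igame H1) * (igame G - igame G1)) +
        sign a * sign (opponent a) * ((igame G1 - igame G2) * (igame H - igame H2)))"
      by (rule pos_add_nonneg)
    then show ?thesis by (cases a) (simp_all add: algebra_simps)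
  next
    case 2
    have "pos (sign a * sign a * ((igame H2 - igame H1) * (igame G - igame G2)))"
      using mono(1) opts(2) H unfolding product_monotone_def by blast
    moreover have "nonneg (sign a * sign a * ((igame G2 - igame G1) * (igame H - igame H1)))"
      using product_monotone_nonneg[OF mono(2,3) opts(3) 2] .
    ultimately have "pos (sign a * sign a * ((igame H2 - igame H1) * (igame G - igame G2)) +
        sign a * sign a * ((igame G2 - igame G1) * (igame H - igame H1)))"
      by (rule pos_add_nonneg)
    then show ?thesis by (cases a) (simp_all add: algebra_simps)
  qed
qed

lemma number_gtimes_step:
  assumes "number G" "number H"
    and num: "\<And>p G'. G' \<in> moves p G \<Longrightarrow> number (gtimes G' H)"
      "\<And>q H'. H' \<in> moves q H \<Longrightarrow> number (gtimes G H')"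
      "\<And>p q G' H'. G' \<in> moves p G \<Longrightarrow> H' \<in> moves q H \<Longrightarrow> number (gtimes G' H')"
    and G: "\<And>p q G1 G2. G1 \<in> moves p G \<Longrightarrow> G2 \<in> moves q G \<Longrightarrow> product_monotone G1 G2 H"
      "\<And>p q r G1 G2 H'. G1 \<in> moves p G \<Longrightarrow> G2 \<in> moves q G \<Longrightarrow> H' \<in> moves r H \<Longrightarrow> product_monotone G1 G2 H'"
    and H: "\<And>p q H1 H2. H1 \<in> moves p H \<Longrightarrow> H2 \<in> moves q H \<Longrightarrow> product_monotone H1 H2 G"
      "\<And>p q r H1 H2 G'. H1 \<in> moves p H \<Longrightarrow> H2 \<in> moves q H \<Longrightarrow> G' \<in> moves r G \<Longrightarrow> product_monotone H1 H2 G'"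
  shows "number (gtimes G H)"
  unfolding number_iff[of "gtimes G H"]
proof (intro conjI allI ballI)
  fix p K assume "K \<in> moves p (gtimes G H)"
  then show "number K"
    unfolding moves_gtimes by (auto simp del: moves.simps intro!: number_gminus number_gplus intro: num)
next
  fix KL KR assume "KL \<in> moves Left (gtimes G H)" "KR \<in> moves Right (gtimes G H)"
  then show "pos (igame KR - igame KL)"
  proof (elim moves_gtimesE)
    fix a a' b b' G1 G2 H1 H2
    assume *: "G1 \<in> moves a G" "H1 \<in> moves a' H" "G2 \<in> moves b G" "H2 \<in> moves b' H"
      and ab: "Left = Left \<longleftrightarrow> a = a'" "Right = Left \<longleftrightarrow> b = b'"
      and K: "igame KL = igame (gtimes G1 H) + igame (gtimes G H1) - igame (gtimes G1 H1)"
        "igame KR = igame (gtimes G2 H) + igame (gtimes G H2) - igame (gtimes G2 H2)"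
    have eq: "igame KR - igame KL =
        (igame G - igame G1) * (igame H - igame H1) - (igame G - igame G2) * (igame H - igame H2)"
      by (simp add: K igame_gtimes algebra_simps)
    have "a' = a" "b' = opponent b" using ab by (cases b; cases b'; auto)+
    show ?thesis
    proof (cases "b = a")
      case True
      then show ?thesis
        unfolding eq using * \<open>a' = a\<close> \<open>b' = opponent b\<close>
        by (intro gtimes_options_less[where a = a] assms(1,2)) (auto intro: G H)
    next
      case False
      then have "b = opponent a" by (cases a; cases b) simp_all
      \<comment> \<open>Now H1 and H2 are options for the same player \<open>a\<close> and G1 and G2
        for different players, so the two factors change roles.\<close>
      then have "pos ((igame H - igame H1) * (igame G - igame G1) - (igame H - igame H2) * (igame G - igame G2))"
        using * \<open>a' = a\<close> \<open>b' = opponent b\<close>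
        by (intro gtimes_options_less[where a = a] assms(1,2)) (auto intro: G H)
      then show ?thesis unfolding eq by (simp add: mult.commute)
    qed
  qed
qed

lemma mult_option_rel:
  assumes "J \<noteq> {#}" "\<And>k. k \<in># K \<Longrightarrow> \<exists>j p. j \<in># J \<and> k \<in> moves p j" "N = I + K" "M = I + J"
  shows "(N, M) \<in> mult option_rel"
  unfolding assms(3,4)
proof (intro one_step_implies_mult assms(1) ballI)
  fix k assume "k \<in># K"
  then obtain j p where "j \<in># J" "k \<in> moves p j" using assms(2) by blast
  then show "\<exists>j\<in>#J. (k, j) \<in> option_rel"
    by (cases p) (auto simp: option_rel_def)
qed

text \<open>The two claims call each other. The product xy being a number needs monotonicity for x1,
  x2 and y with two options x1, x2 of x; monotonicity for x, y and z needs the products xz and yz.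
  The multiset extension of the option relation decreases in both directions although the number of
  members changes. Quantifying over M with two possible shapes puts both claims under one
  induction.\<close>

lemma number_gtimes_and_product_monotone:
  "(M = {#x, y#} \<longrightarrow> number x \<longrightarrow> number y \<longrightarrow> number (gtimes x y)) \<and>
   (M = {#x, y, z#} \<longrightarrow> number x \<longrightarrow> number y \<longrightarrow> number z \<longrightarrow> product_monotone x y z)"
proof (induction M arbitrary: x y z rule: wf_induct_rule[OF wf_mult[OF wf_option_rel]])
  case (1 M)
  have num: "number (gtimes x y)" if "({#x, y#}, M) \<in> mult option_rel" "number x" "number y" for x y
    using 1[OF that(1)] that(2,3) by blast
  have mono: "product_monotone x y z"
    if "({#x, y, z#}, M) \<in> mult option_rel" "number x" "number y" "number z" for x y z
    using 1[OF that(1)] that(2-) by blast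
  show ?case
  proof (intro conjI impI)
    assume M: "M = {#x, y#}" and xy: "number x" "number y"
    show "number (gtimes x y)"
    proof (rule number_gtimes_step)
      show "number (gtimes x' y)" if "x' \<in> moves p x" for p x'
        using that xy
        by (intro num mult_option_rel[of "{#x#}" "{#x'#}" _ "{#y#}"]) (auto simp: M intro: number_moves)
      show "number (gtimes x y')" if "y' \<in> moves p y" for p y'
        using that xy
        by (intro num mult_option_rel[of "{#y#}" "{#y'#}" _ "{#x#}"]) (auto simp: M intro: number_moves)
      show "number (gtimes x' y')" if "x' \<in> moves p x" "y' \<in> moves q y" for p q x' y'
        using that xy
        by (intro num mult_option_rel[of "{#x, y#}" "{#x', y'#}" _ "{#}"]) (auto simp: M intro: number_moves)
      show "product_monotone x1 x2 y" if "x1 \<in> moves p x" "x2 \<in> moves q x" for p q x1 x2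
        using that xy
        by (intro mono mult_option_rel[of "{#x#}" "{#x1, x2#}" _ "{#y#}"]) (auto simp: M intro: number_moves)
      show "product_monotone x1 x2 y'" if "x1 \<in> moves p x" "x2 \<in> moves q x" "y' \<in> moves r y" for p q r x1 x2 y'
        using that xy
        by (intro mono mult_option_rel[of "{#x, y#}" "{#x1, x2, y'#}" _ "{#}"]) (auto simp: M intro: number_moves)
      show "product_monotone y1 y2 x" if "y1 \<in> moves p y" "y2 \<in> moves q y" for p q y1 y2
        using that xy
        by (intro mono mult_option_rel[of "{#y#}" "{#y1, y2#}" _ "{#x#}"]) (auto simp: M intro: number_moves)
      show "product_monotone y1 y2 x'" if "y1 \<in> moves p y" "y2 \<in> moves q y" "x' \<in> moves r x" for p q r y1 y2 x'
        using that xy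
        by (intro mono mult_option_rel[of "{#x, y#}" "{#y1, y2, x'#}" _ "{#}"]) (auto simp: M intro: number_moves)
    qed (fact xy)+
  next
    assume M: "M = {#x, y, z#}" and xyz: "number x" "number y" "number z"
    show "product_monotone x y z"
    proof (rule product_monotone_step)
      show "number (gtimes x z)" using xyz
        by (intro num mult_option_rel[of "{#y#}" "{#}" _ "{#x, z#}"]) (auto simp: M)
      show "number (gtimes y z)" using xyz
        by (intro num mult_option_rel[of "{#x#}" "{#}" _ "{#y, z#}"]) (auto simp: M)
      show "product_monotone x y z'" if "z' \<in> moves p z" for p z'
        using that xyz
        by (intro mono mult_option_rel[of "{#z#}" "{#z'#}" _ "{#x, y#}"]) (auto simp: M intro: number_moves)
      show "product_monotone x' y z" if "x' \<in> moves p x" for p x'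
        using that xyz
        by (intro mono mult_option_rel[of "{#x#}" "{#x'#}" _ "{#y, z#}"]) (auto simp: M intro: number_moves)
      show "product_monotone x' y z'" if "x' \<in> moves p x" "z' \<in> moves q z" for p q x' z'
        using that xyz
        by (intro mono mult_option_rel[of "{#x, z#}" "{#x', z'#}" _ "{#y#}"]) (auto simp: M intro: number_moves)
      show "product_monotone y' x z" if "y' \<in> moves p y" for p y'
        using that xyz
        by (intro mono mult_option_rel[of "{#y#}" "{#y'#}" _ "{#x, z#}"]) (auto simp: M intro: number_moves)
      show "product_monotone y' x z'" if "y' \<in> moves p y" "z' \<in> moves q z" for p q y' z'
        using that xyz
        by (intro mono mult_option_rel[of "{#y, z#}" "{#y', z'#}" _ "{#x#}"]) (auto simp: M intro: number_moves)
    qed (fact xyz)+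
  qed
qed

lemma number_gtimes: "number G \<Longrightarrow> number H \<Longrightarrow> number (gtimes G H)"
  using number_gtimes_and_product_monotone by blast

text \<open>The null clause of \<open>product_monotone\<close> with the first number taken to be
  0.\<close>

lemma null_mult:
  assumes "number G" "number H" "null (igame G)"
  shows "null (igame G * igame H)"
  using number_gtimes_and_product_monotone[of "{#gzero, G, H#}" gzero G H] assms
  by (simp add: product_monotone_def igame_gzero number_gzero)

section \<open>The rings of classes\<close>

definition iter_class :: "'g::game_universe \<Rightarrow> 'g set" where
  "iter_class G = iter_eq `` {G}"

definition conway_class :: "'g::game_universe \<Rightarrow> 'g set" where
  "conway_class G = conway_eq `` {G}"

lemma mem_iter_class: "H \<in> iter_class G \<longleftrightarrow> igame G = igame H"
  by (simp add: iter_class_def igame.abs_eq_iff)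

lemma iter_class_eq_iff: "iter_class G = iter_class H \<longleftrightarrow> igame G = igame H"
  using mem_iter_class[of _ G] mem_iter_class[of _ H] by (metis Set.set_eqI)

lemma mem_conway_class: "H \<in> conway_class G \<longleftrightarrow> null (igame G - igame H)"
  by (simp add: conway_class_def conway_eq_def conway_zero_iff igame_gminus)

lemma conway_class_eq_iff: "conway_class G = conway_class H \<longleftrightarrow> null (igame G - igame H)"
proof
  assume "conway_class G = conway_class H"
  moreover have "H \<in> conway_class H" by (simp add: mem_conway_class null_0)
  ultimately show "null (igame G - igame H)" by (simp flip: mem_conway_class)
next
  assume *: "null (igame G - igame H)"
  show "conway_class G = conway_class H"
  proof (rule Set.set_eqI)
    fix K
    show "K \<in> conway_class G \<longleftrightarrow> K \<in> conway_class H"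
      using null_add[OF *, of "igame H - igame K"] null_diff[OF _ *, of "igame G - igame K"]
      by (auto simp: mem_conway_class)
  qed
qed

lemma PG_ring_carrier: "carrier PG_ring = range iter_class"
  by (auto simp: PG_ring_def quotient_def iter_class_def)

lemma PG_ring_zero: "\<zero>\<^bsub>PG_ring\<^esub> = iter_class gzero"
  by (simp add: PG_ring_def iter_class_def)

lemma PG_ring_one: "\<one>\<^bsub>PG_ring\<^esub> = iter_class gone"
  by (simp add: PG_ring_def iter_class_def)

lemma UN2_eq_const:
  assumes "x \<in> A" "y \<in> B" "\<And>x y. x \<in> A \<Longrightarrow> y \<in> B \<Longrightarrow> F x y = C"
  shows "(\<Union>x\<in>A. \<Union>y\<in>B. F x y) = C"
  using assms by auto

lemma PG_ring_add: "iter_class G \<oplus>\<^bsub>PG_ring\<^esub> iter_class H = iter_class (gplus G H)"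
proof -
  have "iter_class G \<oplus>\<^bsub>PG_ring\<^esub> iter_class H =
      (\<Union>G'\<in>iter_class G. \<Union>H'\<in>iter_class H. iter_class (gplus G' H'))"
    by (simp add: PG_ring_def iter_class_def)
  also have "\<dots> = iter_class (gplus G H)"
    by (rule UN2_eq_const[of G _ H]) (simp_all add: mem_iter_class iter_class_eq_iff igame_gplus)
  finally show ?thesis .
qed

lemma PG_ring_mult: "iter_class G \<otimes>\<^bsub>PG_ring\<^esub> iter_class H = iter_class (gtimes G H)"
proof -
  have "iter_class G \<otimes>\<^bsub>PG_ring\<^esub> iter_class H =
      (\<Union>G'\<in>iter_class G. \<Union>H'\<in>iter_class H. iter_class (gtimes G' H'))"
    by (simp add: PG_ring_def iter_class_def)
  also have "\<dots> = iter_class (gtimes G H)"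
    by (rule UN2_eq_const[of G _ H]) (simp_all add: mem_iter_class iter_class_eq_iff igame_gtimes)
  finally show ?thesis .
qed

lemmas PG_ring_simps = PG_ring_carrier PG_ring_zero PG_ring_one PG_ring_add PG_ring_mult

lemma cring_PG_ring: "cring PG_ring"
proof (rule cringI)
  show "abelian_group PG_ring"
  proof (rule abelian_groupI)
    fix X assume "X \<in> carrier PG_ring"
    then obtain G where "X = iter_class G" by (auto simp: PG_ring_carrier)
    then show "\<exists>Y\<in>carrier PG_ring. Y \<oplus>\<^bsub>PG_ring\<^esub> X = \<zero>\<^bsub>PG_ring\<^esub>"
      by (intro bexI[of _ "iter_class (gneg G)"])
        (simp_all add: PG_ring_simps iter_class_eq_iff igame_simps rangeI)
  qed (auto simp: PG_ring_simps mem_iter_class igame_simps algebra_simps)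
  show "comm_monoid PG_ring"
    by (rule comm_monoidI) (auto simp: PG_ring_simps mem_iter_class igame_ring_simps algebra_simps)
qed (auto simp: PG_ring_simps mem_iter_class igame_ring_simps algebra_simps)

section \<open>The SubRing of numbers\<close>

lemma Numb_classes_eq: "Numb_classes = iter_class ` Collect number"
  by (auto simp: Numb_classes_def iter_class_def)

lemma subring_Numb_classes: "subring Numb_classes (PG_ring :: 'g::game_universe set ring)"
proof -
  interpret cring "PG_ring :: 'g set ring" by (rule cring_PG_ring)
  show ?thesis
  proof (rule subringI)
    fix X :: "'g set" assume "X \<in> Numb_classes"
    then obtain G where G: "X = iter_class G" "number G" by (auto simp: Numb_classes_eq)
    have "\<ominus>\<^bsub>PG_ring\<^esub> X = iter_class (gneg G)"
      by (rule minus_equality) (simp_all add: G PG_ring_simps iter_class_eq_iff igame_simps rangeI)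
    then show "\<ominus>\<^bsub>PG_ring\<^esub> X \<in> Numb_classes"
      using G number_gneg by (auto simp: Numb_classes_eq)
  qed (auto simp: Numb_classes_eq PG_ring_simps number_gone number_gplus number_gtimes)
qed

lemma ring_Numb_ring: "ring Numb_ring"
  using ring.subring_is_ring[OF cring.axioms(1)[OF cring_PG_ring] subring_Numb_classes]
  by (simp add: Numb_ring_def)

lemma Numb_ring_carrier: "carrier Numb_ring = iter_class ` Collect number"
  by (simp add: Numb_ring_def Numb_classes_eq)

lemma Numb_ring_simps:
  "monoid.mult Numb_ring = monoid.mult PG_ring" "add Numb_ring = add PG_ring"
  "one Numb_ring = one PG_ring" "zero Numb_ring = zero PG_ring"
  by (simp_all add: Numb_ring_def)

section \<open>Surreal numbers and the homomorphism onto them\<close>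

lemma surreal_ring_carrier: "carrier surreal_ring = conway_class ` Collect number"
  by (auto simp: surreal_ring_def conway_class_def)

lemma surreal_ring_zero: "\<zero>\<^bsub>surreal_ring\<^esub> = conway_class gzero"
  by (simp add: surreal_ring_def conway_class_def)

lemma surreal_ring_one: "\<one>\<^bsub>surreal_ring\<^esub> = conway_class gone"
  by (simp add: surreal_ring_def conway_class_def)

lemma surreal_ring_add:
  assumes "number G" "number H"
  shows "conway_class G \<oplus>\<^bsub>surreal_ring\<^esub> conway_class H = conway_class (gplus G H)"
proof -
  have "conway_class G \<oplus>\<^bsub>surreal_ring\<^esub> conway_class H =
      (\<Union>G'\<in>Collect number \<inter> conway_class G. \<Union>H'\<in>Collect number \<inter> conway_class H.
        conway_class (gplus G' H'))"
    by (simp add: surreal_ring_def conway_class_def)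
  also have "\<dots> = conway_class (gplus G H)"
  proof (rule UN2_eq_const[of G _ H])
    fix G' H' assume "G' \<in> Collect number \<inter> conway_class G" "H' \<in> Collect number \<inter> conway_class H"
    then have "null (- ((igame G - igame G') + (igame H - igame H')))"
      unfolding null_uminus by (intro null_add) (simp_all add: mem_conway_class)
    then show "conway_class (gplus G' H') = conway_class (gplus G H)"
      by (simp add: conway_class_eq_iff igame_gplus algebra_simps)
  qed (use assms in \<open>simp_all add: mem_conway_class null_0\<close>)
  finally show ?thesis .
qed

text \<open>GH - G'H' = (G - G')H + (H - H')G', and both summands are null by
  \<open>null_mult\<close>, which applies because the representatives are numbers.\<close>

lemma surreal_ring_mult:
  assumes "number G" "number H"
  shows "conway_class G \<otimes>\<^bsub>surreal_ring\<^esub> conway_class H = conway_class (gtimes G H)"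
proof -
  have "conway_class G \<otimes>\<^bsub>surreal_ring\<^esub> conway_class H =
      (\<Union>G'\<in>Collect number \<inter> conway_class G. \<Union>H'\<in>Collect number \<inter> conway_class H.
        conway_class (gtimes G' H'))"
    by (simp add: surreal_ring_def conway_class_def)
  also have "\<dots> = conway_class (gtimes G H)"
  proof (rule UN2_eq_const[of G _ H])
    fix G' H' assume *: "G' \<in> Collect number \<inter> conway_class G" "H' \<in> Collect number \<inter> conway_class H"
    have "null (igame (gminus G G') * igame H)" "null (igame (gminus H H') * igame G')"
      by (rule null_mult; use * assms in \<open>simp add: mem_conway_class igame_gminus number_gminus\<close>)+
    then have "null (- (igame (gminus G G') * igame H + igame (gminus H H') * igame G'))"
      unfolding null_uminus by (rule null_add)
    then show "conway_class (gtimes G' H') = conway_class (gtimes G H)"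
      by (simp add: conway_class_eq_iff igame_ring_simps algebra_simps)
  qed (use assms in \<open>simp_all add: mem_conway_class null_0\<close>)
  finally show ?thesis .
qed

text \<open>Iterative equivalence is finer than Conway equivalence, so all members of the class have
  the same Conway class and their union is that class. The relational image therefore defines the
  map between classes without choosing representatives.\<close>

lemma conway_class_iter_class: "conway_eq `` iter_class G = conway_class G"
proof -
  have "conway_eq `` iter_class G = (\<Union>H\<in>iter_class G. conway_class H)"
    by (auto simp: conway_class_def)
  also have "\<dots> = conway_class G"
  proof -
    have "conway_class H = conway_class G" if "H \<in> iter_class G" for H
      using that by (simp add: mem_iter_class conway_class_eq_iff null_0)
    moreover have "G \<in> iter_class G" by (simp add: mem_iter_class)
    ultimately show ?thesis by blast
  qed
  finally show ?thesis .
qed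

lemma ring_hom_ring_conway:
  "ring_hom_ring (Numb_ring :: 'g::game_universe set ring) surreal_ring ((``) conway_eq)"
proof -
  have hom: "(``) conway_eq \<in> ring_hom (Numb_ring :: 'g set ring) surreal_ring"
    by (rule ring_hom_memI)
      (clarsimp simp: Numb_ring_carrier Numb_ring_simps PG_ring_simps conway_class_iter_class number_gplus
        number_gtimes surreal_ring_carrier surreal_ring_add surreal_ring_mult surreal_ring_one)+
  \<comment> \<open>The ring axioms of \<open>surreal_ring\<close> are inherited from
    \<open>Numb_ring\<close>: the image of a ring under a homomorphism is a ring, and here the image
    has the full carrier and the right zero.\<close>
  have "ring ((surreal_ring :: 'g set ring)\<lparr>carrier := (``) conway_eq ` carrier Numb_ring,
      zero := conway_eq `` \<zero>\<^bsub>Numb_ring\<^esub>\<rparr>)"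
    by (rule ring.ring_hom_imp_img_ring[OF ring_Numb_ring hom])
  also have "(``) conway_eq ` carrier Numb_ring = carrier (surreal_ring :: 'g set ring)"
    by (simp add: surreal_ring_carrier Numb_ring_carrier image_image conway_class_iter_class)
  also have "conway_eq `` \<zero>\<^bsub>Numb_ring\<^esub> = \<zero>\<^bsub>(surreal_ring :: 'g set ring)\<^esub>"
    by (simp add: surreal_ring_zero Numb_ring_simps PG_ring_zero conway_class_iter_class)
  finally have "ring (surreal_ring :: 'g set ring)" by simp
  then show ?thesis by (rule ring_hom_ringI2[OF ring_Numb_ring _ hom])
qed

text \<open>The number and the Conway zero game that represent a class may differ, but being null
  depends only on the class, so the number itself is Conway zero.\<close>

lemma Conway_zero_classes_eq:
  "Conway_zero_classes = iter_class ` {G :: 'g::game_universe. number G \<and> null (igame G)}"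
proof -
  have "{iter_eq `` {G} |G :: 'g. conway_zero G} = iter_class ` {G. null (igame G)}"
    by (auto simp: iter_class_def conway_zero_iff)
  then have "Conway_zero_classes = iter_class ` Collect number \<inter> iter_class ` {G :: 'g. null (igame G)}"
    by (simp add: Conway_zero_classes_def Numb_classes_eq)
  also have "\<dots> = iter_class ` {G. number G \<and> null (igame G)}"
  proof (intro equalityI subsetI)
    fix X assume "X \<in> iter_class ` Collect number \<inter> iter_class ` {G. null (igame G)}"
    then obtain G H where "X = iter_class G" "number G" "X = iter_class H" "null (igame H)" by blast
    moreover from this have "igame G = igame H" by (simp add: iter_class_eq_iff)
    ultimately show "X \<in> iter_class ` {G. number G \<and> null (igame G)}" by auto
  qed auto
  finally show ?thesis .
qed

lemma a_kernel_conway: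
  "a_kernel Numb_ring (surreal_ring :: 'g::game_universe set ring) ((``) conway_eq) = Conway_zero_classes"
proof -
  have "conway_eq `` iter_class G = \<zero>\<^bsub>surreal_ring\<^esub> \<longleftrightarrow> null (igame G)" for G :: 'g
    by (simp add: surreal_ring_zero conway_class_iter_class conway_class_eq_iff igame_gzero)
  then show ?thesis
    by (auto simp: a_kernel_def' Numb_ring_carrier Conway_zero_classes_eq)
qed

theorem proposition5p2:
  shows "cring (PG_ring :: 'g::game_universe set ring)
    \<and> subring (Numb_classes :: 'g set set) (PG_ring :: 'g set ring)
    \<and> ideal (Conway_zero_classes :: 'g set set) (Numb_ring :: 'g set ring)
    \<and> (Numb_ring :: 'g set ring) Quot (Conway_zero_classes :: 'g set set)
        \<simeq> (surreal_ring :: 'g set ring)"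
proof (intro conjI cring_PG_ring subring_Numb_classes)
  interpret ring_hom_ring "Numb_ring :: 'g set ring" surreal_ring "(``) conway_eq"
    by (rule ring_hom_ring_conway)
  show "ideal (Conway_zero_classes :: 'g set set) Numb_ring"
    using kernel_is_ideal by (simp add: a_kernel_conway)
  show "(Numb_ring :: 'g set ring) Quot Conway_zero_classes \<simeq> (surreal_ring :: 'g set ring)"
    \<comment> \<open>The remaining premise is surjectivity: the image of the class of a number is
      its Conway class, and every surreal number arises so.\<close>
    using FactRing_iso
    by (simp add: a_kernel_conway surreal_ring_carrier Numb_ring_carrier image_image conway_class_iter_class)
qed

end
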